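(* Let $t\geq s\geq 2$ be integers and let $0<\alpha<1$ be a real number. Then for all sufficiently large $n$ the following holds: if $G$ is a $K_{s,t}$ minor-free graph of order $n$, then $\rho_\alpha(G)$ is no more than the largest root of $f_\alpha(x)=0$, where $$f_\alpha(x)=x^2-\big(\alpha n+s+t-3\big)x+\big(\alpha(n-s+1)+s-2\big)\big(\alpha(s-1)+t-1\big)-(1-\alpha)^2(s-1)(n-s+1),$$ and equality holds if and only if $n-s+1=pt$ for some integer $p$ and $G=K_{s-1}\nabla pK_t$ (up to isomorphism).
   Context: All graphs are finite, simple and undirected; the order of a graph is its number of vertices. For a graph $G$ with adjacency matrix $A(G)$ and diagonal degree matrix $D(G)$, and a real number $0\le\alpha\le 1$, let $A_\alpha(G)=\alpha D(G)+(1-\alpha)A(G)$; the $\alpha$-index $\rho_\alpha(G)$ is the largest eigenvalue of $A_\alpha(G)$. $K_m$ is the complete graph on $m$ vertices, $K_{s,t}$ the complete bipartite graph with parts of sizes $s$ and $t$, $pG$ is the union of $p$ vertex-disjoint copies of $G$, and $G\nabla H$ is the join of vertex-disjoint graphs $G,H$, obtained by joining every vertex of $G$ to every vertex of $H$. A graph $H$ is a minor of $G$ if it can be obtained from $G$ by deleting edges, contracting edges or deleting vertices; $G$ is $H$ minor-free if it does not contain $H$ as a minor. *)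

theory Defs
  imports Complex_Main "Jordan_Normal_Form.Spectral_Radius"
begin

section \<open>Finite simple undirected graphs\<close>

text \<open>An edge is the two-element set of its end vertices.\<close>

record 'a ugraph =
  verts :: "'a set"
  edges :: "'a set set"

definition simple_graph :: "'a ugraph \<Rightarrow> bool" where
  "simple_graph G \<longleftrightarrow> finite (verts G) \<and> (\<forall>e\<in>edges G. e \<subseteq> verts G \<and> card e = 2)"

definition graph_order :: "'a ugraph \<Rightarrow> nat" where
  "graph_order G = card (verts G)"

definition vdegree :: "'a ugraph \<Rightarrow> 'a \<Rightarrow> nat" where
  "vdegree G v = card {u \<in> verts G. {u, v} \<in> edges G}"

definition iso_graph :: "'a ugraph \<Rightarrow> 'b ugraph \<Rightarrow> bool" where
  "iso_graph G H \<longleftrightarrow>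
     (\<exists>f. bij_betw f (verts G) (verts H) \<and> edges H = (\<lambda>e. f ` e) ` edges G)"

definition complete_graph :: "nat \<Rightarrow> nat ugraph" where
  "complete_graph m = \<lparr>verts = {..<m}, edges = {e. e \<subseteq> {..<m} \<and> card e = 2}\<rparr>"

definition complete_bipartite :: "nat \<Rightarrow> nat \<Rightarrow> (nat + nat) ugraph" where
  "complete_bipartite s t =
     \<lparr>verts = {..<s} <+> {..<t}, edges = {{Inl i, Inr j} | i j. i < s \<and> j < t}\<rparr>"

definition copies :: "nat \<Rightarrow> 'a ugraph \<Rightarrow> (nat \<times> 'a) ugraph" where
  "copies p G =
     \<lparr>verts = {..<p} \<times> verts G, edges = {Pair i ` e | i e. i < p \<and> e \<in> edges G}\<rparr>"

definition graph_join :: "'a ugraph \<Rightarrow> 'b ugraph \<Rightarrow> ('a + 'b) ugraph" where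
  "graph_join G H =
     \<lparr>verts = verts G <+> verts H,
      edges = (\<lambda>e. Inl ` e) ` edges G \<union> (\<lambda>e. Inr ` e) ` edges H
              \<union> {{Inl u, Inr v} | u v. u \<in> verts G \<and> v \<in> verts H}\<rparr>"


section \<open>Minors\<close>

definition delete_edge :: "'a set \<Rightarrow> 'a ugraph \<Rightarrow> 'a ugraph" where
  "delete_edge e G = \<lparr>verts = verts G, edges = edges G - {e}\<rparr>"

definition delete_vertex :: "'a \<Rightarrow> 'a ugraph \<Rightarrow> 'a ugraph" where
  "delete_vertex v G = \<lparr>verts = verts G - {v}, edges = {e \<in> edges G. v \<notin> e}\<rparr>"

text \<open>Contracting the edge between \<open>u\<close> and \<open>v\<close> merges \<open>v\<close> into \<open>u\<close>.  The cardinality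
  condition drops the loop that the contracted edge becomes; parallel edges coincide as sets.\<close>

definition contract_edge :: "'a \<Rightarrow> 'a \<Rightarrow> 'a ugraph \<Rightarrow> 'a ugraph" where
  "contract_edge u v G =
     \<lparr>verts = verts G - {v},
      edges = {e' \<in> (\<lambda>e. (\<lambda>w. if w = v then u else w) ` e) ` edges G. card e' = 2}\<rparr>"

inductive minor_step :: "'a ugraph \<Rightarrow> 'a ugraph \<Rightarrow> bool" where
  del_edge: "e \<in> edges G \<Longrightarrow> minor_step G (delete_edge e G)"
| del_vertex: "v \<in> verts G \<Longrightarrow> minor_step G (delete_vertex v G)"
| contract: "{u, v} \<in> edges G \<Longrightarrow> u \<noteq> v \<Longrightarrow> minor_step G (contract_edge u v G)"

definition has_minor :: "'a ugraph \<Rightarrow> 'b ugraph \<Rightarrow> bool" where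
  "has_minor G H \<longleftrightarrow> (\<exists>G'. minor_step\<^sup>*\<^sup>* G G' \<and> iso_graph G' H)"

abbreviation minor_free :: "'b ugraph \<Rightarrow> 'a ugraph \<Rightarrow> bool" where
  "minor_free H G \<equiv> \<not> has_minor G H"


section \<open>The matrix \<open>A\<^sub>\<alpha>\<close> and the \<open>\<alpha>\<close>-index\<close>

text \<open>Matrices have rows and columns indexed by \<open>{..<n}\<close>, so the vertices are numbered in some
  fixed way.  Another numbering conjugates the matrices below by a permutation matrix, hence
  does not change the spectrum.\<close>

definition vertex_at :: "'a ugraph \<Rightarrow> nat \<Rightarrow> 'a" where
  "vertex_at G = (SOME f. bij_betw f {..<graph_order G} (verts G))"

definition adjacency_matrix :: "'a ugraph \<Rightarrow> real mat" where
  "adjacency_matrix G = mat (graph_order G) (graph_order G)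
     (\<lambda>(i, j). if {vertex_at G i, vertex_at G j} \<in> edges G then 1 else 0)"

definition degree_matrix :: "'a ugraph \<Rightarrow> real mat" where
  "degree_matrix G = mat (graph_order G) (graph_order G)
     (\<lambda>(i, j). if i = j then real (vdegree G (vertex_at G i)) else 0)"

definition A_alpha :: "real \<Rightarrow> 'a ugraph \<Rightarrow> real mat" where
  "A_alpha \<alpha> G = \<alpha> \<cdot>\<^sub>m degree_matrix G + (1 - \<alpha>) \<cdot>\<^sub>m adjacency_matrix G"

text \<open>The spectrum of a real matrix consists of its real eigenvalues; since \<open>A\<^sub>\<alpha>\<close> is symmetric,
  these are all of them, and for a nonempty graph the set is finite and nonempty.\<close>

definition alpha_index :: "real \<Rightarrow> 'a ugraph \<Rightarrow> real" where
  "alpha_index \<alpha> G = Max (spectrum (A_alpha \<alpha> G))"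


section \<open>The quadratic \<open>f\<^sub>\<alpha>\<close>\<close>

definition f_alpha :: "nat \<Rightarrow> nat \<Rightarrow> nat \<Rightarrow> real \<Rightarrow> real \<Rightarrow> real" where
  "f_alpha s t n \<alpha> x =
     x\<^sup>2 - (\<alpha> * real n + real s + real t - 3) * x
     + (\<alpha> * (real n - real s + 1) + real s - 2) * (\<alpha> * (real s - 1) + real t - 1)
     - (1 - \<alpha>)\<^sup>2 * (real s - 1) * (real n - real s + 1)"

text \<open>For \<open>n \<ge> s \<ge> 1\<close> the discriminant of \<open>f\<^sub>\<alpha>\<close> is a sum of nonnegative terms, so the set below
  is nonempty.\<close>

definition largest_root :: "(real \<Rightarrow> real) \<Rightarrow> real" where
  "largest_root f = Max {x. f x = 0}"

end

theory Submission
  imports Defs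
begin

text \<open>
  Let \<open>\<rho>\<close> be the largest root of \<open>f\<^sub>\<alpha>\<close>, let \<open>k = s - 1\<close>, and suppose that an eigenvalue
  \<open>\<lambda> \<ge> \<rho>\<close> has the eigenvector \<open>z\<close>; put \<open>x = |z|\<close>, scaled to maximum \<open>1\<close>. Excluding
  \<open>K\<^sub>s\<^sub>,\<^sub>t\<close> as a subgraph already bounds the number of vertices of degree above \<open>\<epsilon>n\<close> by a constant and
  leaves at most \<open>k\<close> vertices of degree close to \<open>n\<close>. Since \<open>\<lambda> > \<alpha>n - O(1)\<close>, the eigenvalue
  inequality makes \<open>x\<close> small at every other vertex, with total weight at most \<open>(1 - \<alpha>)k/\<alpha> + o(1)\<close>.
  At a vertex with \<open>x = 1\<close> the inequality \<open>\<lambda> \<ge> \<rho> = \<alpha>(n - 1) + (1 - \<alpha>)(k/\<alpha> - 1) - o(1)\<close> is then so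
  tight that there are exactly \<open>k\<close> vertices of large degree, and all of them are adjacent to every
  other vertex. Beyond this set \<open>S\<close> the degrees are at most \<open>t - 1\<close>, and pairing \<open>x\<close> with a vector
  that is constant on \<open>S\<close> and on its complement gives \<open>\<lambda> \<le> \<rho>\<close>, with equality only if \<open>G - S\<close> is
  \<open>(t - 1)\<close>-regular.

  Minors are needed only here: a connected set in \<open>G - S\<close> with \<open>t\<close> neighbours outside \<open>S\<close> yields,
  together with \<open>S\<close>, a \<open>K\<^sub>s\<^sub>,\<^sub>t\<close> minor, and so does a vertex \<open>a\<close> of \<open>G - S\<close> with a connected set
  that avoids \<open>a\<close> and its neighbours and is adjacent to all of the latter. In a
  \<open>(t - 1)\<close>-regular graph without these two configurations adjacency is transitive.
\<close>

section \<open>Neighbourhoods\<close>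

definition nbrs :: "'a ugraph \<Rightarrow> 'a \<Rightarrow> 'a set" where
  "nbrs G u = {v \<in> verts G. {v, u} \<in> edges G}"

lemma vdegree_nbrs: "vdegree G u = card (nbrs G u)"
  by (simp add: vdegree_def nbrs_def)

lemma nbrs_subset_verts: "nbrs G u \<subseteq> verts G"
  by (auto simp: nbrs_def)

context
  fixes G :: "'a ugraph"
  assumes G: "simple_graph G"
begin

lemma finite_verts: "finite (verts G)"
  using G by (simp add: simple_graph_def)

lemma finite_nbrs: "finite (nbrs G u)"
  using finite_verts nbrs_subset_verts finite_subset by metis

lemma edgeD:
  assumes "{u, v} \<in> edges G"
  shows "u \<in> verts G" "v \<in> verts G" "u \<noteq> v"
  using G assms by (auto simp: simple_graph_def dest!: bspec)

lemma mem_nbrs: "v \<in> nbrs G u \<longleftrightarrow> {v, u} \<in> edges G"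
  using edgeD by (auto simp: nbrs_def)

lemma nbrs_sym: "v \<in> nbrs G u \<longleftrightarrow> u \<in> nbrs G v"
  by (simp add: mem_nbrs insert_commute)

lemma not_mem_nbrs_self: "u \<notin> nbrs G u"
  using edgeD mem_nbrs by blast

lemma edges_altdef: "edges G = {{u, v} | u v. v \<in> nbrs G u}"
proof -
  have "\<exists>u v. e = {u, v} \<and> v \<in> nbrs G u" if "e \<in> edges G" for e
  proof -
    have "card e = 2" using G that by (auto simp: simple_graph_def)
    then obtain u v where "e = {u, v}" by (auto simp: card_2_iff)
    then show ?thesis using that mem_nbrs insert_commute by metis
  qed
  then show ?thesis by (auto simp: mem_nbrs insert_commute)
qed

lemma card_nbrs_less: "u \<in> verts G \<Longrightarrow> card (nbrs G u) < card (verts G)"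
  using finite_verts nbrs_subset_verts not_mem_nbrs_self by (metis psubsetI psubset_card_mono)

text \<open>Both sides run over the ordered adjacent pairs with one end in \<open>A\<close> and the
  other in \<open>B\<close>. The double counts below and the symmetry of \<open>A_alpha\<close> are
  instances.\<close>

lemma sum_nbrs_swap:
  fixes f :: "'a \<Rightarrow> 'a \<Rightarrow> 'b :: comm_monoid_add"
  assumes "A \<subseteq> verts G" "B \<subseteq> verts G"
  shows "(\<Sum>u\<in>A. \<Sum>v\<in>nbrs G u \<inter> B. f u v) = (\<Sum>v\<in>B. \<Sum>u\<in>nbrs G v \<inter> A. f u v)"
proof -
  have fin: "finite A" "finite B" using assms finite_verts finite_subset by blast+
  have "(\<Sum>u\<in>A. \<Sum>v\<in>nbrs G u \<inter> B. f u v) = (\<Sum>u\<in>A. \<Sum>v\<in>B. if v \<in> nbrs G u then f u v else 0)"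
    using fin by (subst sum.inter_filter[symmetric]) (simp_all add: Int_def conj_commute)
  also have "\<dots> = (\<Sum>v\<in>B. \<Sum>u\<in>A. if u \<in> nbrs G v then f u v else 0)"
    by (subst sum.swap) (simp add: nbrs_sym)
  also have "\<dots> = (\<Sum>v\<in>B. \<Sum>u\<in>nbrs G v \<inter> A. f u v)"
    using fin by (subst sum.inter_filter[symmetric]) (simp_all add: Int_def conj_commute)
  finally show ?thesis .
qed

end

section \<open>Complete bipartite minors\<close>

lemma minor_step_simple_graph:
  assumes "minor_step G G'" "simple_graph G"
  shows "simple_graph G'"
  using assms
proof cases
  case (del_edge e)
  then show ?thesis using assms(2) by (auto simp: simple_graph_def delete_edge_def)
next
  case (del_vertex v)
  then show ?thesis using assms(2) by (fastforce simp: simple_graph_def delete_vertex_def)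
next
  case (contract u v)
  have u: "u \<in> verts G" using edgeD[OF assms(2)] contract by blast
  show ?thesis
    using assms(2) contract(3) u unfolding contract(1) simple_graph_def contract_edge_def
    by (auto split: if_splits)
qed

lemma minor_steps_simple_graph:
  "minor_step\<^sup>*\<^sup>* G G' \<Longrightarrow> simple_graph G \<Longrightarrow> simple_graph G'"
  by (induction rule: rtranclp_induct) (auto dest: minor_step_simple_graph)

lemma minor_steps_delete_edges:
  assumes "finite F" "F \<subseteq> edges G"
  shows "minor_step\<^sup>*\<^sup>* G \<lparr>verts = verts G, edges = edges G - F\<rparr>"
  using assms
proof (induction F rule: finite_induct)
  case empty
  show ?case by (cases G) simp
next
  case (insert e F)
  let ?H = "\<lparr>verts = verts G, edges = edges G - F\<rparr>"
  have "minor_step ?H (delete_edge e ?H)"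
    using insert by (intro minor_step.del_edge) auto
  moreover have "delete_edge e ?H = \<lparr>verts = verts G, edges = edges G - insert e F\<rparr>"
    by (auto simp: delete_edge_def)
  ultimately show ?case using insert by (metis (no_types, lifting) insert_subset rtranclp.rtrancl_into_rtrancl)
qed

lemma minor_steps_delete_vertices:
  assumes "finite F" "F \<subseteq> verts G"
  shows "minor_step\<^sup>*\<^sup>* G \<lparr>verts = verts G - F, edges = {e \<in> edges G. e \<inter> F = {}}\<rparr>"
  using assms
proof (induction F rule: finite_induct)
  case empty
  show ?case by (cases G) simp
next
  case (insert v F)
  let ?H = "\<lparr>verts = verts G - F, edges = {e \<in> edges G. e \<inter> F = {}}\<rparr>"
  have "minor_step ?H (delete_vertex v ?H)"
    using insert by (intro minor_step.del_vertex) auto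
  moreover have "delete_vertex v ?H = \<lparr>verts = verts G - insert v F, edges = {e \<in> edges G. e \<inter> insert v F = {}}\<rparr>"
    by (auto simp: delete_vertex_def)
  ultimately show ?case using insert by (metis (no_types, lifting) insert_subset rtranclp.rtrancl_into_rtrancl)
qed

text \<open>Delete the vertices outside \<open>X\<close> and \<open>Y\<close>, then all edges that
  do not run between \<open>X\<close> and \<open>Y\<close>; edges inside \<open>X\<close> or
  \<open>Y\<close> therefore do no harm.\<close>

lemma has_minor_complete_bipartite_subgraph:
  assumes G: "simple_graph G" and "X \<subseteq> verts G" "Y \<subseteq> verts G" "X \<inter> Y = {}"
    and "card X = s" "card Y = t"
    and complete: "\<And>x y. x \<in> X \<Longrightarrow> y \<in> Y \<Longrightarrow> {x, y} \<in> edges G"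
  shows "has_minor G (complete_bipartite s t)"
proof -
  have finV: "finite (verts G)" using G by (rule finite_verts)
  have finX: "finite X" and finY: "finite Y" using assms finV finite_subset by blast+
  define E where "E = {{x, y} | x y. x \<in> X \<and> y \<in> Y}"
  define G1 where "G1 = \<lparr>verts = verts G - (verts G - (X \<union> Y)), edges = {e \<in> edges G. e \<inter> (verts G - (X \<union> Y)) = {}}\<rparr>"
  have "minor_step\<^sup>*\<^sup>* G G1"
    unfolding G1_def using finV by (intro minor_steps_delete_vertices) auto
  moreover have V1: "verts G1 = X \<union> Y" using assms by (auto simp: G1_def)
  moreover have E1: "E \<subseteq> edges G1" using complete by (auto simp: E_def G1_def)
  have "edges G1 \<subseteq> Pow (verts G)" using G by (auto simp: simple_graph_def G1_def)
  then have "finite (edges G1)" using finV by (meson finite_Pow_iff finite_subset)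
  then have "minor_step\<^sup>*\<^sup>* G1 \<lparr>verts = verts G1, edges = edges G1 - (edges G1 - E)\<rparr>"
    using minor_steps_delete_edges[of "edges G1 - E" G1] by blast
  moreover have "edges G1 - (edges G1 - E) = E" using E1 by blast
  ultimately have steps: "minor_step\<^sup>*\<^sup>* G \<lparr>verts = X \<union> Y, edges = E\<rparr>"
    by (metis (no_types, lifting) rtranclp_trans)
  obtain f where f: "bij_betw f X {..<s}"
    using finX assms(5) by (metis bij_betw_iff_card card_lessThan finite_lessThan)
  obtain g where g: "bij_betw g Y {..<t}"
    using finY assms(6) by (metis bij_betw_iff_card card_lessThan finite_lessThan)
  define h where "h v = (if v \<in> X then Inl (f v) else Inr (g v))" for v
  have fX: "f ` X = {..<s}" "inj_on f X" and gY: "g ` Y = {..<t}" "inj_on g Y"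
    using f g by (auto simp: bij_betw_def)
  have hX: "h ` X = Inl ` {..<s}" and hY: "h ` Y = Inr ` {..<t}"
  proof -
    have "h ` X = Inl ` f ` X" unfolding image_image by (intro image_cong) (auto simp: h_def)
    then show "h ` X = Inl ` {..<s}" using fX by simp
    have "h ` Y = Inr ` g ` Y" unfolding image_image using assms(4) by (intro image_cong) (auto simp: h_def)
    then show "h ` Y = Inr ` {..<t}" using gY by simp
  qed
  have "bij_betw h (X \<union> Y) ({..<s} <+> {..<t})"
  proof -
    have "inj_on h (X \<union> Y)"
      using fX(2) gY(2) assms(4) by (auto simp: inj_on_def h_def)
    then show ?thesis using hX hY by (simp add: bij_betw_def image_Un Plus_def)
  qed
  moreover have "{{Inl i, Inr j} | i j. i < s \<and> j < t} = (\<lambda>e. h ` e) ` E" (is "?L = ?R")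
  proof
    show "?L \<subseteq> ?R"
    proof
      fix e assume "e \<in> ?L"
      then obtain i j where e: "e = {Inl i, Inr j}" "i < s" "j < t" by blast
      then have "(Inl i :: nat + nat) \<in> h ` X" "(Inr j :: nat + nat) \<in> h ` Y" using hX hY by auto
      then obtain x y where "x \<in> X" "y \<in> Y" "h x = Inl i" "h y = Inr j" by (metis imageE)
      then have "e = h ` {x, y}" "{x, y} \<in> E" using e by (auto simp: E_def)
      then show "e \<in> ?R" by blast
    qed
    show "?R \<subseteq> ?L"
    proof
      fix e assume "e \<in> ?R"
      then obtain x y where e: "e = {h x, h y}" "x \<in> X" "y \<in> Y" by (auto simp: E_def)
      then have "h x \<in> Inl ` {..<s}" "h y \<in> Inr ` {..<t}" using hX hY by blast+
      then obtain i j where ij: "h x = Inl i" "h y = Inr j" "i < s" "j < t" by (auto simp only: image_iff lessThan_iff)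
      have "e = {Inl i, Inr j}" using e(1) ij(1,2) by simp
      with ij(3,4) show "e \<in> ?L" by (intro CollectI exI[of _ i] exI[of _ j] conjI)
    qed
  qed
  ultimately have "iso_graph \<lparr>verts = X \<union> Y, edges = E\<rparr> (complete_bipartite s t)"
    unfolding iso_graph_def complete_bipartite_def by auto
  then show ?thesis using steps unfolding has_minor_def by blast
qed

section \<open>Contraction of connected sets\<close>

text \<open>Connected vertex sets containing \<open>w\<close>, presented by an order in which each
  new vertex is adjacent to an earlier one. The contraction of the set into \<open>w\<close> follows
  this order.\<close>

inductive grown :: "'a ugraph \<Rightarrow> 'a \<Rightarrow> 'a set \<Rightarrow> bool" for G w where
  single: "grown G w {w}"
| extend: "grown G w W \<Longrightarrow> u \<in> W \<Longrightarrow> v \<notin> W \<Longrightarrow> {u, v} \<in> edges G \<Longrightarrow> grown G w (insert v W)"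

lemma grown_mem: "grown G w W \<Longrightarrow> w \<in> W"
  by (induction rule: grown.induct) auto

lemma grown_finite: "grown G w W \<Longrightarrow> finite W"
  by (induction rule: grown.induct) auto

lemma minor_steps_contract_grown:
  assumes "grown G w W" "simple_graph G"
  shows "\<exists>G'. minor_step\<^sup>*\<^sup>* G G' \<and> verts G' = verts G - (W - {w})
     \<and> (\<forall>u v. u \<notin> W \<longrightarrow> v \<notin> W \<longrightarrow> {u, v} \<in> edges G \<longrightarrow> {u, v} \<in> edges G')
     \<and> (\<forall>u v. u \<in> W \<longrightarrow> v \<notin> W \<longrightarrow> {u, v} \<in> edges G \<longrightarrow> {w, v} \<in> edges G')"
  using assms(1)
proof (induction rule: grown.induct)
  case single
  show ?case by (intro exI[of _ G]) auto
next
  case (extend W u v)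
  then obtain G' where G': "minor_step\<^sup>*\<^sup>* G G'" "verts G' = verts G - (W - {w})"
    and out: "\<And>u v. u \<notin> W \<Longrightarrow> v \<notin> W \<Longrightarrow> {u, v} \<in> edges G \<Longrightarrow> {u, v} \<in> edges G'"
    and cross: "\<And>u v. u \<in> W \<Longrightarrow> v \<notin> W \<Longrightarrow> {u, v} \<in> edges G \<Longrightarrow> {w, v} \<in> edges G'"
    by metis
  have sG': "simple_graph G'" using minor_steps_simple_graph G' assms(2) by blast
  have wW: "w \<in> W" using extend grown_mem by metis
  have wv: "{w, v} \<in> edges G'" using cross extend by blast
  have "w \<noteq> v" using wW extend by blast
  define H where "H = contract_edge w v G'"
  have "minor_step G' H" unfolding H_def using wv \<open>w \<noteq> v\<close> by (rule minor_step.contract)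
  then have steps: "minor_step\<^sup>*\<^sup>* G H" using G' by (metis rtranclp.rtrancl_into_rtrancl)
  \<comment> \<open>The renaming in \<open>contract_edge\<close>; an edge survives it as long as its
    two ends stay distinct.\<close>
  let ?r = "\<lambda>x. if x = v then w else x"
  have img: "{?r x, ?r y} \<in> edges H" if "{x, y} \<in> edges G'" "?r x \<noteq> ?r y" for x y
  proof -
    have "{?r x, ?r y} = ?r ` {x, y}" by (simp only: image_insert image_empty)
    then have "{?r x, ?r y} \<in> (\<lambda>e. ?r ` e) ` edges G'" using that(1) by (rule image_eqI)
    moreover have "card {?r x, ?r y} = 2" using that(2) by (simp only: card_2_iff) blast
    ultimately show ?thesis unfolding H_def contract_edge_def ugraph.simps by (intro CollectI conjI)
  qed
  have "{x, y} \<in> edges H" if "x \<notin> insert v W" "y \<notin> insert v W" "{x, y} \<in> edges G" for x y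
    using img[of x y] out[of x y] that edgeD[OF assms(2), of x y] by auto
  moreover have "{w, y} \<in> edges H" if "x \<in> insert v W" "y \<notin> insert v W" "{x, y} \<in> edges G" for x y
  proof (cases "x = v")
    case True
    then have "{v, y} \<in> edges G'" using out extend that by auto
    then show ?thesis using img[of v y] that wW by auto
  next
    case False
    then have "{w, y} \<in> edges G'" using cross that by blast
    then show ?thesis using img[of w y] that wW by auto
  qed
  moreover have "verts H = verts G - (insert v W - {w})"
    using G'(2) extend \<open>w \<noteq> v\<close> by (auto simp: H_def contract_edge_def)
  ultimately show ?case using steps by blast
qed

lemma has_minor_trans_steps: "minor_step\<^sup>*\<^sup>* G G' \<Longrightarrow> has_minor G' H \<Longrightarrow> has_minor G H"
  unfolding has_minor_def by (meson rtranclp_trans)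

text \<open>Contracting \<open>W\<close> leaves the vertex \<open>w\<close>, which completes
  \<open>X\<close> to a side of \<open>Suc k\<close> vertices because every vertex of
  \<open>Y\<close> has a neighbour in \<open>W\<close>.\<close>

lemma has_bipartite_minor:
  assumes G: "simple_graph G" and W: "grown G w W" "W \<subseteq> verts G"
    and X: "X \<subseteq> verts G - W" "card X = k" and Y: "Y \<subseteq> verts G - W" "card Y = t" and "X \<inter> Y = {}"
    and complete: "\<And>x y. x \<in> X \<Longrightarrow> y \<in> Y \<Longrightarrow> {x, y} \<in> edges G"
    and attached: "\<And>y. y \<in> Y \<Longrightarrow> \<exists>u\<in>W. {u, y} \<in> edges G"
  shows "has_minor G (complete_bipartite (Suc k) t)"
proof -
  obtain G' where G': "minor_step\<^sup>*\<^sup>* G G'" "verts G' = verts G - (W - {w})"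
    and out: "\<And>u v. u \<notin> W \<Longrightarrow> v \<notin> W \<Longrightarrow> {u, v} \<in> edges G \<Longrightarrow> {u, v} \<in> edges G'"
    and cross: "\<And>u v. u \<in> W \<Longrightarrow> v \<notin> W \<Longrightarrow> {u, v} \<in> edges G \<Longrightarrow> {w, v} \<in> edges G'"
    using minor_steps_contract_grown[OF W(1) G] by metis
  have w: "w \<in> W" using W grown_mem by metis
  have "finite X" using X finite_verts[OF G] by (meson finite_Diff finite_subset)
  have "has_minor G' (complete_bipartite (Suc k) t)"
  proof (rule has_minor_complete_bipartite_subgraph[where X = "insert w X" and Y = Y])
    show "simple_graph G'" using minor_steps_simple_graph G' G by blast
    show "insert w X \<subseteq> verts G'" "Y \<subseteq> verts G'" "insert w X \<inter> Y = {}"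
      using G' W X Y w assms(8) by auto
    show "card (insert w X) = Suc k" using X w \<open>finite X\<close> by (subst card_insert_disjoint) auto
    show "card Y = t" by fact
    show "{x, y} \<in> edges G'" if "x \<in> insert w X" "y \<in> Y" for x y
    proof (cases "x = w")
      case True
      then show ?thesis using attached[OF that(2)] cross that Y by blast
    next
      case False
      then have "x \<in> X" using that by simp
      then show ?thesis using complete out that X Y by blast
    qed
  qed
  then show ?thesis using has_minor_trans_steps G' by blast
qed

section \<open>The spectrum of \<open>A\<^sub>\<alpha>\<close>\<close>

lemma mult_mat_vec_index:
  assumes "A \<in> carrier_mat n n" "v \<in> carrier_vec n" "i < n"
  shows "(A *\<^sub>v v) $ i = (\<Sum>j<n. A $$ (i, j) * v $ j)"
  using assms by (simp add: scalar_prod_def lessThan_atLeast0)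

lemma eigenvalue_iff_sum:
  assumes A: "A \<in> carrier_mat n n"
  shows "eigenvalue A k \<longleftrightarrow>
    (\<exists>z. (\<exists>i<n. z i \<noteq> 0) \<and> (\<forall>i<n. (\<Sum>j<n. A $$ (i, j) * z j) = k * z i))"
proof
  assume "eigenvalue A k"
  then obtain v where v: "v \<in> carrier_vec n" "v \<noteq> 0\<^sub>v n" "A *\<^sub>v v = k \<cdot>\<^sub>v v"
    using A by (auto simp: eigenvalue_def eigenvector_def)
  have "\<exists>i<n. v $ i \<noteq> 0" using v(1,2) by (auto simp: vec_eq_iff)
  moreover have "(\<Sum>j<n. A $$ (i, j) * v $ j) = k * v $ i" if "i < n" for i
    using mult_mat_vec_index[OF A v(1) that] v that by simp
  ultimately show "\<exists>z. (\<exists>i<n. z i \<noteq> 0) \<and> (\<forall>i<n. (\<Sum>j<n. A $$ (i, j) * z j) = k * z i)"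
    by blast
next
  assume "\<exists>z. (\<exists>i<n. z i \<noteq> 0) \<and> (\<forall>i<n. (\<Sum>j<n. A $$ (i, j) * z j) = k * z i)"
  then obtain z where z: "\<exists>i<n. z i \<noteq> 0" "\<forall>i<n. (\<Sum>j<n. A $$ (i, j) * z j) = k * z i"
    by blast
  have "A *\<^sub>v vec n z = k \<cdot>\<^sub>v vec n z"
  proof (rule eq_vecI)
    fix i assume "i < dim_vec (k \<cdot>\<^sub>v vec n z)"
    then have "i < n" by simp
    then show "(A *\<^sub>v vec n z) $ i = (k \<cdot>\<^sub>v vec n z) $ i"
      using z(2) by (subst mult_mat_vec_index[OF A]) auto
  qed (use A in auto)
  moreover have "vec n z \<noteq> 0\<^sub>v n" using z(1) by (auto simp: vec_eq_iff)
  ultimately show "eigenvalue A k"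
    using A unfolding eigenvalue_def eigenvector_def by (intro exI[of _ "vec n z"]) auto
qed

text \<open>Over the complex numbers an eigenvalue \<open>c\<close> exists. Symmetry makes the
  Hermitian form \<open>q = c * m\<close> real, and \<open>m > 0\<close>, so \<open>c\<close> is
  real. Then the real and the imaginary part of the eigenvector both satisfy the eigenvalue
  equation, and one of them is nonzero.\<close>

lemma symmetric_real_spectrum_nonempty:
  fixes A :: "real mat"
  assumes A: "A \<in> carrier_mat n n" and "n > 0"
    and sym: "\<And>i j. i < n \<Longrightarrow> j < n \<Longrightarrow> A $$ (i, j) = A $$ (j, i)"
  shows "spectrum A \<noteq> {}"
proof -
  let ?C = "map_mat complex_of_real A"
  have C: "?C \<in> carrier_mat n n" using A by simp
  obtain c where "eigenvalue ?C c"
    using spectrum_non_empty[OF C \<open>n > 0\<close>] by (auto simp: spectrum_def)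
  then obtain z where z: "\<exists>i<n. z i \<noteq> 0"
    "\<And>i. i < n \<Longrightarrow> (\<Sum>j<n. complex_of_real (A $$ (i, j)) * z j) = c * z i"
    unfolding eigenvalue_iff_sum[OF C] using A by auto
  define q where "q = (\<Sum>i<n. \<Sum>j<n. complex_of_real (A $$ (i, j)) * cnj (z i) * z j)"
  define m where "m = (\<Sum>i<n. (cmod (z i))\<^sup>2)"
  have "q = (\<Sum>i<n. cnj (z i) * (\<Sum>j<n. complex_of_real (A $$ (i, j)) * z j))"
    by (simp add: q_def sum_distrib_left algebra_simps)
  also have "\<dots> = (\<Sum>i<n. c * (z i * cnj (z i)))"
    using z(2) by (intro sum.cong) (auto simp: algebra_simps)
  also have "\<dots> = c * complex_of_real m"
    unfolding m_def of_real_sum sum_distrib_left by (simp only: complex_norm_square)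
  finally have q: "q = c * complex_of_real m" .
  have "cnj q = (\<Sum>i<n. \<Sum>j<n. complex_of_real (A $$ (i, j)) * z i * cnj (z j))"
    by (simp add: q_def)
  also have "\<dots> = (\<Sum>j<n. \<Sum>i<n. complex_of_real (A $$ (i, j)) * z i * cnj (z j))"
    by (rule sum.swap)
  also have "\<dots> = q" unfolding q_def using sym by (intro sum.cong) (auto simp: algebra_simps)
  finally have "Im q = 0" by (metis cnj.simps(2) neg_equal_zero)
  moreover have "m > 0" unfolding m_def using z(1) by (auto intro!: sum_pos2)
  ultimately have "Im c = 0" using q by simp
  then have c: "c = complex_of_real (Re c)" by (simp add: complex_eq_iff)
  have ReIm: "(\<Sum>j<n. A $$ (i, j) * Re (z j)) = Re c * Re (z i)"
    "(\<Sum>j<n. A $$ (i, j) * Im (z j)) = Re c * Im (z i)" if "i < n" for i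
    using arg_cong[OF z(2)[OF that], of Re] arg_cong[OF z(2)[OF that], of Im] \<open>Im c = 0\<close>
    by simp_all
  have "eigenvalue A (Re c)"
  proof (cases "\<exists>i<n. Re (z i) \<noteq> 0")
    case True
    then show ?thesis using ReIm unfolding eigenvalue_iff_sum[OF A]
      by (intro exI[of _ "\<lambda>i. Re (z i)"]) auto
  next
    case False
    then have "\<exists>i<n. Im (z i) \<noteq> 0" using z(1) by (auto simp: complex_eq_iff)
    then show ?thesis using ReIm unfolding eigenvalue_iff_sum[OF A]
      by (intro exI[of _ "\<lambda>i. Im (z i)"]) auto
  qed
  then show ?thesis by (auto simp: spectrum_def)
qed

section \<open>The matrix as an operator on functions on the vertices\<close>

lemma A_alpha_carrier: "A_alpha \<alpha> G \<in> carrier_mat (graph_order G) (graph_order G)"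
  by (simp add: A_alpha_def degree_matrix_def adjacency_matrix_def)

lemma A_alpha_index:
  assumes "i < graph_order G" "j < graph_order G"
  shows "A_alpha \<alpha> G $$ (i, j) =
    \<alpha> * (if i = j then real (vdegree G (vertex_at G i)) else 0)
    + (1 - \<alpha>) * (if {vertex_at G i, vertex_at G j} \<in> edges G then 1 else 0)"
  using assms by (simp add: A_alpha_def degree_matrix_def adjacency_matrix_def)

lemma bij_betw_vertex_at:
  assumes "simple_graph G"
  shows "bij_betw (vertex_at G) {..<graph_order G} (verts G)"
proof -
  have "\<exists>f. bij_betw f {..<graph_order G} (verts G)"
    using ex_bij_betw_nat_finite[OF finite_verts[OF assms]]
    by (simp add: graph_order_def lessThan_atLeast0)
  then show ?thesis unfolding vertex_at_def by (rule someI_ex)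
qed

text \<open>Transport along the numbering of the vertices removes indices: the estimates below use
  the matrix only through this equation.\<close>

lemma eigenvalue_A_alpha_iff:
  assumes G: "simple_graph G"
  shows "eigenvalue (A_alpha \<alpha> G) k \<longleftrightarrow>
    (\<exists>z. (\<exists>u\<in>verts G. z u \<noteq> 0) \<and>
      (\<forall>u\<in>verts G. \<alpha> * real (vdegree G u) * z u + (1 - \<alpha>) * (\<Sum>v\<in>nbrs G u. z v) = k * z u))"
    (is "_ \<longleftrightarrow> (\<exists>z. ?P z)")
proof -
  define n where "n = graph_order G"
  define f where "f = vertex_at G"
  have f: "bij_betw f {..<n} (verts G)" using bij_betw_vertex_at[OF G] by (simp add: f_def n_def)
  have img: "f ` {..<n} = verts G" using f by (simp add: bij_betw_def)
  have row: "(\<Sum>j<n. A_alpha \<alpha> G $$ (i, j) * z (f j)) =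
      \<alpha> * real (vdegree G (f i)) * z (f i) + (1 - \<alpha>) * (\<Sum>v\<in>nbrs G (f i). z v)"
    if i: "i < n" for i and z :: "'a \<Rightarrow> real"
  proof -
    have "(\<Sum>j<n. A_alpha \<alpha> G $$ (i, j) * z (f j)) =
        (\<Sum>j<n. (if i = j then \<alpha> * real (vdegree G (f i)) * z (f i) else 0)
           + (1 - \<alpha>) * (if f j \<in> nbrs G (f i) then z (f j) else 0))"
      using i by (intro sum.cong)
        (auto simp: A_alpha_index n_def[symmetric] f_def[symmetric] mem_nbrs[OF G] insert_commute
          algebra_simps)
    also have "\<dots> = \<alpha> * real (vdegree G (f i)) * z (f i)
        + (1 - \<alpha>) * (\<Sum>j<n. if f j \<in> nbrs G (f i) then z (f j) else 0)"
      using i by (simp add: sum.distrib sum_distrib_left)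
    also have "(\<Sum>j<n. if f j \<in> nbrs G (f i) then z (f j) else 0)
        = (\<Sum>v\<in>verts G. if v \<in> nbrs G (f i) then z v else 0)"
      using sum.reindex_bij_betw[OF f] by fast
    also have "\<dots> = (\<Sum>v\<in>nbrs G (f i). z v)"
      using finite_verts[OF G] nbrs_subset_verts[of G "f i"]
      by (simp add: sum.inter_restrict[symmetric] Int_absorb1)
    finally show ?thesis .
  qed
  have "(\<exists>z. ?P z) \<longleftrightarrow> (\<exists>w. (\<exists>i<n. w i \<noteq> 0) \<and> (\<forall>i<n. (\<Sum>j<n. A_alpha \<alpha> G $$ (i, j) * w j) = k * w i))"
    (is "_ \<longleftrightarrow> (\<exists>w. ?Q w)")
  proof
    assume "\<exists>z. ?P z"
    then obtain z where "?P z" by blast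
    then have "?Q (\<lambda>i. z (f i))" unfolding img[symmetric] by (auto simp: row)
    then show "\<exists>w. ?Q w" by (rule exI[where x = "\<lambda>i. z (f i)"])
  next
    assume "\<exists>w. ?Q w"
    then obtain w where w: "?Q w" by blast
    define z where "z u = w (inv_into {..<n} f u)" for u
    have zf: "z (f i) = w i" if "i < n" for i
      using f that by (simp add: z_def bij_betw_def)
    have "(\<Sum>j<n. A_alpha \<alpha> G $$ (i, j) * z (f j)) = (\<Sum>j<n. A_alpha \<alpha> G $$ (i, j) * w j)" for i
      by (intro sum.cong) (auto simp: zf)
    then have "(\<Sum>j<n. A_alpha \<alpha> G $$ (i, j) * z (f j)) = k * z (f i)" if "i < n" for i
      using w that by (simp add: zf)
    then have "\<forall>i<n. \<alpha> * real (vdegree G (f i)) * z (f i) + (1 - \<alpha>) * (\<Sum>v\<in>nbrs G (f i). z v) = k * z (f i)"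
      by (simp add: row)
    moreover have "\<exists>i<n. z (f i) \<noteq> 0" using w zf by auto
    ultimately have "?P z" unfolding img[symmetric] by auto
    then show "\<exists>z. ?P z" by (rule exI[where x = z])
  qed
  then show ?thesis
    using eigenvalue_iff_sum[OF A_alpha_carrier] unfolding n_def by simp
qed

lemma finite_spectrum_A_alpha: "finite (spectrum (A_alpha \<alpha> G))"
  using card_finite_spectrum(1)[OF A_alpha_carrier] .

lemma alpha_index_eigenvalue:
  assumes "graph_order G > 0"
  shows "eigenvalue (A_alpha \<alpha> G) (alpha_index \<alpha> G)"
proof -
  have "spectrum (A_alpha \<alpha> G) \<noteq> {}"
    using symmetric_real_spectrum_nonempty[OF A_alpha_carrier assms]
    by (simp add: A_alpha_index insert_commute)
  then have "alpha_index \<alpha> G \<in> spectrum (A_alpha \<alpha> G)"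
    unfolding alpha_index_def using finite_spectrum_A_alpha by (intro Max_in) auto
  then show ?thesis by (simp add: spectrum_def)
qed

lemma eigenvalue_le_alpha_index: "eigenvalue (A_alpha \<alpha> G) k \<Longrightarrow> k \<le> alpha_index \<alpha> G"
  unfolding alpha_index_def using finite_spectrum_A_alpha by (intro Max_ge) (auto simp: spectrum_def)

section \<open>Entries of subeigenvectors\<close>

text \<open>The assumption \<open>bipartite_free\<close> excludes \<open>K_{s,t}\<close> as a
  subgraph, since a common neighbour of \<open>X\<close> never lies in \<open>X\<close>. The bounds
  for the entries use the absence of minors only in this weak form.\<close>

locale bipartite_free_graph =
  fixes G :: "'a ugraph" and s t :: nat
  assumes simple: "simple_graph G"
    and bipartite_free: "\<And>X. X \<subseteq> verts G \<Longrightarrow> card X = s \<Longrightarrow> card {v \<in> verts G. X \<subseteq> nbrs G v} < t"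
    and s_pos: "s > 0"
begin

abbreviation "n \<equiv> card (verts G)"
abbreviation "deg u \<equiv> card (nbrs G u)"

lemmas finV = finite_verts[OF simple] and finN = finite_nbrs[OF simple]

text \<open>Double counting of the pairs of a large-degree vertex and a neighbour: few vertices have
  \<open>s\<close> neighbours in a fixed finite set.\<close>

lemma card_large_degree_less:
  assumes "real s \<le> real M * \<epsilon>" "M > 0" "M * ((t - 1) * (M choose s)) < n"
  shows "card {u \<in> verts G. real (deg u) > \<epsilon> * real n} < M"
proof (rule ccontr)
  assume "\<not> ?thesis"
  then obtain B where B: "B \<subseteq> {u \<in> verts G. real (deg u) > \<epsilon> * real n}" "card B = M"
    by (metis (no_types, lifting) linorder_not_less obtain_subset_with_card_n)
  then have BV: "B \<subseteq> verts G" by blast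
  then have finB: "finite B" using finV finite_subset by blast
  \<comment> \<open>Each vertex with at least \<open>s\<close> neighbours in \<open>B\<close> is a
    common neighbour of some \<open>s\<close>-subset of \<open>B\<close>, and each such subset has
    at most \<open>t - 1\<close> common neighbours.\<close>
  define W where "W = {w \<in> verts G. s \<le> card (nbrs G w \<inter> B)}"
  define \<X> where "\<X> = {X. X \<subseteq> B \<and> card X = s}"
  have fin\<X>: "finite \<X>" using finB by (simp add: \<X>_def)
  have "W \<subseteq> (\<Union>X\<in>\<X>. {v \<in> verts G. X \<subseteq> nbrs G v})"
  proof
    fix w assume "w \<in> W"
    then obtain X where "X \<subseteq> nbrs G w \<inter> B" "card X = s" unfolding W_def
      by (metis (no_types, lifting) mem_Collect_eq obtain_subset_with_card_n)
    then show "w \<in> (\<Union>X\<in>\<X>. {v \<in> verts G. X \<subseteq> nbrs G v})"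
      using \<open>w \<in> W\<close> by (auto simp: W_def \<X>_def)
  qed
  then have "card W \<le> card (\<Union>X\<in>\<X>. {v \<in> verts G. X \<subseteq> nbrs G v})"
    using fin\<X> finV by (intro card_mono) auto
  also have "\<dots> \<le> (\<Sum>X\<in>\<X>. card {v \<in> verts G. X \<subseteq> nbrs G v})"
    using fin\<X> by (rule card_UN_le)
  also have "\<dots> \<le> (\<Sum>X\<in>\<X>. t - 1)"
  proof (rule sum_mono)
    fix X assume "X \<in> \<X>"
    then have "card {v \<in> verts G. X \<subseteq> nbrs G v} < t"
      using BV by (intro bipartite_free) (auto simp: \<X>_def)
    then show "card {v \<in> verts G. X \<subseteq> nbrs G v} \<le> t - 1" by simp
  qed
  also have "\<dots> = (t - 1) * (M choose s)" using n_subsets[OF finB, of s] B by (simp add: \<X>_def)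
  finally have cardW: "card W \<le> (t - 1) * (M choose s)" .
  \<comment> \<open>Counted from \<open>B\<close> there are at least \<open>s * n\<close> pairs.
    Counted from the other end there are at most \<open>s - 1\<close> per vertex outside
    \<open>W\<close> and at most \<open>M\<close> extra per vertex of \<open>W\<close>, which is
    less than \<open>s * n\<close> in total.\<close>
  have "s * n \<le> (\<Sum>u\<in>B. deg u)"
  proof -
    have "real s * real n \<le> (\<Sum>u\<in>B. \<epsilon> * real n)"
      using assms(1) B by (simp add: mult_right_mono flip: mult.assoc)
    also have "\<dots> \<le> (\<Sum>u\<in>B. real (deg u))" using B by (intro sum_mono) (auto simp: less_imp_le)
    finally have "real (s * n) \<le> real (\<Sum>u\<in>B. deg u)" by simp
    then show ?thesis by (simp only: of_nat_le_iff)
  qed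
  also have "\<dots> = (\<Sum>u\<in>B. \<Sum>w\<in>nbrs G u \<inter> verts G. 1)"
    using nbrs_subset_verts[of G] by (simp add: Int_absorb2)
  also have "\<dots> = (\<Sum>w\<in>verts G. card (nbrs G w \<inter> B))"
    using sum_nbrs_swap[OF simple BV order_refl, of "\<lambda>_ _. 1::nat"] by simp
  also have "\<dots> \<le> (\<Sum>w\<in>verts G. (s - 1) + (if w \<in> W then M else 0))"
  proof (rule sum_mono)
    fix w assume "w \<in> verts G"
    have "card (nbrs G w \<inter> B) \<le> M" using finB B by (metis card_mono inf_le2)
    then show "card (nbrs G w \<inter> B) \<le> (s - 1) + (if w \<in> W then M else 0)"
      using \<open>w \<in> verts G\<close> by (auto simp: W_def)
  qed
  also have "\<dots> = (s - 1) * n + M * card W"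
    using finV by (simp add: sum.distrib sum.inter_restrict[symmetric] W_def Int_absorb1 mult.commute)
      (simp add: sum.If_cases Int_def conj_commute)
  also have "\<dots> \<le> (s - 1) * n + M * ((t - 1) * (M choose s))" using cardW by simp
  also have "\<dots> < (s - 1) * n + n" using assms(3) by simp
  also have "\<dots> = s * n" using s_pos by (metis add.commute mult_Suc Suc_diff_1)
  finally show False by simp
qed

section \<open>Vertices of degree close to the order\<close>

text \<open>With this value \<open>s\<close> vertices that each miss at most
  \<open>\<delta> * n\<close> vertices still have at least \<open>\<delta> * n\<close> common
  neighbours, as \<open>1 - s * \<delta> = \<delta>\<close>.\<close>

definition \<delta> :: real where "\<delta> = 1 / (real s + 1)"

definition S :: "'a set" where "S = {u \<in> verts G. real (deg u) > (1 - \<delta>) * real n}"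

lemma \<delta>: "0 < \<delta>" "\<delta> \<le> 1 / 2" "1 - real s * \<delta> = \<delta>"
  using s_pos by (simp_all add: \<delta>_def field_simps)

lemma S_subset: "S \<subseteq> verts G"
  by (auto simp: S_def)

lemma finS: "finite S"
  using S_subset finV finite_subset by blast

text \<open>By the union bound on non-neighbours, \<open>s\<close> vertices of \<open>S\<close>
  would have at least \<open>\<delta> * n \<ge> t\<close> common neighbours.\<close>

lemma card_S_less:
  assumes "real t \<le> \<delta> * real n"
  shows "card S < s"
proof (rule ccontr)
  assume "\<not> ?thesis"
  then obtain X where X: "X \<subseteq> S" "card X = s" by (metis linorder_not_less obtain_subset_with_card_n)
  have finX: "finite X" using X finS finite_subset by blast
  let ?C = "{v \<in> verts G. X \<subseteq> nbrs G v}"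
  have "verts G \<subseteq> ?C \<union> (\<Union>u\<in>X. verts G - nbrs G u)"
    using nbrs_sym[OF simple] by auto
  then have "n \<le> card (?C \<union> (\<Union>u\<in>X. verts G - nbrs G u))"
    using finX finV by (intro card_mono) auto
  also have "\<dots> \<le> card ?C + (\<Sum>u\<in>X. card (verts G - nbrs G u))"
    by (rule order_trans[OF card_Un_le add_left_mono[OF card_UN_le[OF finX]]])
  finally have "real n \<le> real (card ?C) + (\<Sum>u\<in>X. real (card (verts G - nbrs G u)))"
    by (simp only: of_nat_sum[symmetric] of_nat_add[symmetric] of_nat_le_iff)
  also have "\<dots> \<le> real (card ?C) + (\<Sum>u\<in>X. \<delta> * real n)"
  proof (intro add_left_mono sum_mono)
    fix u assume "u \<in> X"
    then have "real (deg u) > (1 - \<delta>) * real n" using X by (auto simp: S_def)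
    moreover have "card (verts G - nbrs G u) = n - deg u" "deg u \<le> n"
      using nbrs_subset_verts[of G u] finN[of u] finV by (auto simp: card_Diff_subset card_mono)
    ultimately show "real (card (verts G - nbrs G u)) \<le> \<delta> * real n"
      by (simp add: algebra_simps)
  qed
  also have "\<dots> = real (card ?C) + real n * (1 - \<delta>)"
    using X arg_cong[OF \<delta>(3), of "\<lambda>y. real n * y"] by (simp add: algebra_simps)
  finally have "\<delta> * real n \<le> real (card ?C)" by (simp add: algebra_simps)
  moreover have "card ?C < t" using X S_subset by (intro bipartite_free) auto
  ultimately show False using assms by simp
qed

end

section \<open>Bounds for the entries outside \<open>S\<close>\<close>

text \<open>What is kept of an eigenvector after taking absolute values and scaling its maximum to
  1. The bound on \<open>lam\<close> gives
  \<open>lam - \<alpha> * deg u \<ge> \<alpha> * (n - 1 - deg u)\<close>, which is of order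
  \<open>n\<close> at vertices outside \<open>S\<close>.\<close>

locale sub_eigenvector = bipartite_free_graph +
  fixes \<alpha> lam :: real and x :: "'a \<Rightarrow> real"
  assumes \<alpha>: "0 < \<alpha>" "\<alpha> < 1"
    and x_nonneg: "\<And>u. u \<in> verts G \<Longrightarrow> 0 \<le> x u" and x_le: "\<And>u. u \<in> verts G \<Longrightarrow> x u \<le> 1"
    and sub: "\<And>u. u \<in> verts G \<Longrightarrow> (lam - \<alpha> * real (deg u)) * x u \<le> (1 - \<alpha>) * (\<Sum>v\<in>nbrs G u. x v)"
    and lam: "\<alpha> * (real n - 1) \<le> lam"
begin

lemma sum_x_nonneg: "A \<subseteq> verts G \<Longrightarrow> 0 \<le> (\<Sum>v\<in>A. x v)"
  using x_nonneg by (intro sum_nonneg) auto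

lemma sum_x_le_card: "A \<subseteq> verts G \<Longrightarrow> (\<Sum>v\<in>A. x v) \<le> real (card A)"
  using sum_bounded_above[of A x 1] x_le by auto

text \<open>Outside \<open>S\<close> the coefficient \<open>lam - \<alpha> * deg w\<close> is at
  least \<open>\<alpha> * \<delta> * n / 2\<close> once \<open>\<delta> * n \<ge> 2\<close>;
  division by it produces the factor \<open>c / n\<close>.\<close>

definition c :: real where "c = 2 * (1 - \<alpha>) / (\<alpha> * \<delta>)"

lemma c_pos: "c > 0"
  using \<alpha> \<delta> by (simp add: c_def)

lemma entry_le_sum_nbrs:
  assumes "w \<in> verts G - S" "2 \<le> \<delta> * real n"
  shows "x w \<le> c / real n * (\<Sum>v\<in>nbrs G w. x v)"
proof -
  have n: "real n > 0" using assms \<delta> by (metis le_numeral_extra(3) mult_zero_right not_numeral_le_zero of_nat_0_le_iff order_le_less)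
  have "real (deg w) \<le> (1 - \<delta>) * real n" using assms by (auto simp: S_def)
  then have "\<alpha> * real (deg w) \<le> \<alpha> * ((1 - \<delta>) * real n)" using \<alpha> by simp
  then have "lam - \<alpha> * real (deg w) \<ge> \<alpha> * (\<delta> * real n - 1)"
    using lam by (simp add: algebra_simps)
  moreover have "\<alpha> * (\<delta> * real n - 1) \<ge> \<alpha> * (\<delta> * real n / 2)"
    using assms \<alpha> by (intro mult_left_mono) auto
  ultimately have "\<alpha> * (\<delta> * real n / 2) * x w \<le> (lam - \<alpha> * real (deg w)) * x w"
    using x_nonneg assms by (intro mult_right_mono) auto
  also have "\<dots> \<le> (1 - \<alpha>) * (\<Sum>v\<in>nbrs G w. x v)" using sub assms by blast
  finally show ?thesis using n \<alpha> \<delta> by (simp add: c_def field_simps)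
qed

lemma entry_le_of_degree_le:
  assumes "w \<in> verts G - S" "2 \<le> \<delta> * real n" "real (deg w) \<le> \<epsilon> * real n"
  shows "x w \<le> c * \<epsilon>"
proof -
  have n: "real n > 0" using assms by (metis mult_zero_right not_numeral_le_zero of_nat_0_le_iff order_le_less)
  have "x w \<le> c / real n * (\<Sum>v\<in>nbrs G w. x v)" using entry_le_sum_nbrs assms by blast
  also have "\<dots> \<le> c / real n * (\<epsilon> * real n)"
    using sum_x_le_card[OF nbrs_subset_verts, of w] assms(3) c_pos n
    by (intro mult_left_mono) auto
  finally show ?thesis using n by simp
qed

text \<open>Since the degree of \<open>w\<close> may be linear in \<open>n\<close>, the entry bound
  is applied twice. The total weight is at most \<open>M\<close> from the vertices of large degree
  plus \<open>c * \<epsilon>\<close> for each other vertex; multiplying by \<open>c / n\<close>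
  gives the claim.\<close>

lemma entry_le:
  assumes "w \<in> verts G - S" "2 \<le> \<delta> * real n" "0 < \<epsilon>" "\<epsilon> \<le> 1 / 2"
    and "real s \<le> real M * \<epsilon>" "M > 0" "M * ((t - 1) * (M choose s)) < n"
  shows "x w \<le> c * real M / real n + c\<^sup>2 * \<epsilon>"
proof -
  define B where "B = {u \<in> verts G. real (deg u) > \<epsilon> * real n}"
  have n: "real n > 0" using assms(2) by (metis mult_zero_right not_numeral_le_zero of_nat_0_le_iff order_le_less)
  have cB: "card B < M" unfolding B_def using assms by (intro card_large_degree_less)
  have BV: "B \<subseteq> verts G" by (auto simp: B_def)
  have "(\<Sum>v\<in>nbrs G w. x v) \<le> (\<Sum>v\<in>verts G. x v)"
    using finV x_nonneg by (intro sum_mono2 nbrs_subset_verts) auto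
  also have "\<dots> = (\<Sum>v\<in>B. x v) + (\<Sum>v\<in>verts G - B. x v)"
    using finV BV by (metis add.commute sum.subset_diff)
  also have "\<dots> \<le> real M + (\<Sum>v\<in>verts G - B. c * \<epsilon>)"
  proof (intro add_mono sum_mono)
    show "sum x B \<le> real M" using sum_x_le_card[OF BV] cB by simp
    fix v assume v: "v \<in> verts G - B"
    then have d: "real (deg v) \<le> \<epsilon> * real n" by (auto simp: B_def)
    also have "\<dots> \<le> (1 - \<delta>) * real n" using assms(4) \<delta>(2) by (intro mult_right_mono) auto
    finally have "v \<notin> S" by (simp add: S_def)
    then show "x v \<le> c * \<epsilon>" using entry_le_of_degree_le[of v \<epsilon>] v d assms by blast
  qed
  also have "\<dots> \<le> real M + real n * (c * \<epsilon>)"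
    using c_pos assms(3) finV by (auto intro!: mult_right_mono card_mono)
  finally have "c / real n * (\<Sum>v\<in>nbrs G w. x v) \<le> c / real n * (real M + real n * (c * \<epsilon>))"
    using c_pos n by (intro mult_left_mono) auto
  also have "\<dots> = c * real M / real n + c\<^sup>2 * \<epsilon>" using n by (simp add: field_simps power2_eq_square)
  finally show ?thesis using entry_le_sum_nbrs assms by (meson order_trans)
qed

text \<open>Sum the inequalities over the complement of \<open>S\<close> and exchange the order of
  summation. Each \<open>v\<close> is charged at most \<open>deg v\<close> times, so the parts
  \<open>\<alpha> * deg\<close> and \<open>(1 - \<alpha>) * deg\<close> add up and the coefficient
  \<open>lam - deg w\<close> remains. It is at least \<open>q\<close> except at fewer than
  \<open>M\<close> vertices of large degree, whose entries are at most
  \<open>\<eta>\<close>.\<close>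

lemma sum_outside_le:
  assumes small: "\<And>w. w \<in> verts G - S \<Longrightarrow> x w \<le> \<eta>" "0 \<le> \<eta>"
    and "real s \<le> real M * \<epsilon>" "M > 0" "M * ((t - 1) * (M choose s)) < n"
    and q: "q = \<alpha> * (real n - 1) - \<epsilon> * real n"
  shows "q * (\<Sum>w\<in>verts G - S. x w) \<le> ((1 - \<alpha>) * real (card S) + real M * \<eta>) * real n"
proof -
  define O' where "O' = verts G - S"
  have O': "O' \<subseteq> verts G" "finite O'" using finV by (auto simp: O'_def)
  define B where "B = {u \<in> verts G. real (deg u) > \<epsilon> * real n}"
  have cB: "card B < M" unfolding B_def using assms by (intro card_large_degree_less)
  have degn: "deg u \<le> n" for u by (rule card_mono[OF finV nbrs_subset_verts])
  have "(\<Sum>w\<in>O'. \<Sum>v\<in>nbrs G w. x v) = (\<Sum>w\<in>O'. (\<Sum>v\<in>nbrs G w \<inter> verts G. x v))"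
    by (simp add: Int_absorb2 nbrs_subset_verts)
  also have "\<dots> = (\<Sum>v\<in>verts G. \<Sum>w\<in>nbrs G v \<inter> O'. x v)"
    using sum_nbrs_swap[OF simple O'(1) order_refl, of "\<lambda>_ v. x v"] .
  also have "\<dots> \<le> (\<Sum>v\<in>verts G. real (deg v) * x v)"
  proof (rule sum_mono)
    fix v assume "v \<in> verts G"
    then show "(\<Sum>w\<in>nbrs G v \<inter> O'. x v) \<le> real (deg v) * x v"
      using x_nonneg finN[of v] by (auto intro!: mult_right_mono card_mono)
  qed
  also have "\<dots> = (\<Sum>v\<in>O'. real (deg v) * x v) + (\<Sum>v\<in>S. real (deg v) * x v)"
    unfolding O'_def by (rule sum.subset_diff[OF S_subset finV])
  also have "\<dots> \<le> (\<Sum>v\<in>O'. real (deg v) * x v) + (\<Sum>v\<in>S. real n * 1)"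
    using degn x_le x_nonneg S_subset by (intro add_left_mono sum_mono mult_mono) auto
  finally have inner: "(\<Sum>w\<in>O'. \<Sum>v\<in>nbrs G w. x v)
      \<le> (\<Sum>v\<in>O'. real (deg v) * x v) + real n * real (card S)"
    by (simp add: mult.commute)
  have "(\<Sum>w\<in>O'. (lam - \<alpha> * real (deg w)) * x w) \<le> (\<Sum>w\<in>O'. (1 - \<alpha>) * (\<Sum>v\<in>nbrs G w. x v))"
    using sub O' by (intro sum_mono) auto
  also have "\<dots> = (1 - \<alpha>) * (\<Sum>w\<in>O'. \<Sum>v\<in>nbrs G w. x v)" by (simp add: sum_distrib_left)
  also have "\<dots> \<le> (1 - \<alpha>) * ((\<Sum>v\<in>O'. real (deg v) * x v) + real n * real (card S))"
    using \<alpha> inner by (intro mult_left_mono) auto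
  finally have "(\<Sum>w\<in>O'. (lam - \<alpha> * real (deg w)) * x w)
      \<le> (1 - \<alpha>) * ((\<Sum>v\<in>O'. real (deg v) * x v) + real n * real (card S))" .
  then have "(\<Sum>w\<in>O'. (lam - \<alpha> * real (deg w)) * x w) - (1 - \<alpha>) * (\<Sum>v\<in>O'. real (deg v) * x v)
      \<le> (1 - \<alpha>) * real (card S) * real n"
    by (simp add: algebra_simps)
  also have "(\<Sum>w\<in>O'. (lam - \<alpha> * real (deg w)) * x w) - (1 - \<alpha>) * (\<Sum>v\<in>O'. real (deg v) * x v)
      = (\<Sum>w\<in>O'. (lam - real (deg w)) * x w)"
    unfolding sum_distrib_left sum_subtractf[symmetric]
    by (intro sum.cong refl) (simp add: algebra_simps)
  finally have upper: "(\<Sum>w\<in>O'. (lam - real (deg w)) * x w) \<le> (1 - \<alpha>) * real (card S) * real n" .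
  have "(\<Sum>w\<in>O'. q * x w - (if w \<in> B then real n * \<eta> else 0)) \<le> (\<Sum>w\<in>O'. (lam - real (deg w)) * x w)"
  proof (rule sum_mono)
    fix w assume w: "w \<in> O'"
    then have xw: "0 \<le> x w" "x w \<le> \<eta>" using x_nonneg small O' by (auto simp: O'_def)
    show "q * x w - (if w \<in> B then real n * \<eta> else 0) \<le> (lam - real (deg w)) * x w"
    proof (cases "w \<in> B")
      case True
      \<comment> \<open>Here the coefficient may be negative, but it is at least
        \<open>q - n\<close>, so the loss against \<open>q * x w\<close> is at most
        \<open>n * \<eta>\<close>.\<close>
      have "0 < real M * \<epsilon>" using assms(3) s_pos by linarith
      then have "0 \<le> \<epsilon>" using \<open>M > 0\<close> by (simp add: zero_less_mult_iff)
      then have "q \<le> lam" using q lam by (smt (verit) mult_nonneg_nonneg of_nat_0_le_iff)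
      then have "(q - real n) * x w \<le> (lam - real (deg w)) * x w"
        using degn[of w] xw by (intro mult_right_mono) auto
      moreover have "real n * x w \<le> real n * \<eta>" using xw by (intro mult_left_mono) auto
      ultimately show ?thesis using True by (simp add: algebra_simps)
    next
      case False
      then have "q \<le> lam - real (deg w)" using w q lam O' by (auto simp: B_def)
      then show ?thesis using False xw by (auto intro: mult_right_mono)
    qed
  qed
  moreover have "(\<Sum>w\<in>O'. q * x w - (if w \<in> B then real n * \<eta> else 0))
      = q * (\<Sum>w\<in>O'. x w) - real (card (O' \<inter> B)) * (real n * \<eta>)"
    using O' by (simp add: sum_subtractf sum_distrib_left sum.inter_restrict[symmetric])
  moreover have "real (card (O' \<inter> B)) * (real n * \<eta>) \<le> real M * (real n * \<eta>)"
  proof -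
    have "finite B" using finV by (simp add: B_def)
    then have "card (O' \<inter> B) \<le> card B" by (intro card_mono) auto
    then show ?thesis using cB \<open>0 \<le> \<eta>\<close> by (intro mult_right_mono) auto
  qed
  ultimately have "q * (\<Sum>w\<in>O'. x w) \<le> (1 - \<alpha>) * real (card S) * real n + real M * (real n * \<eta>)"
    using upper by linarith
  then show ?thesis unfolding O'_def by (simp add: algebra_simps)
qed

end

section \<open>The dominating vertices\<close>

context sub_eigenvector
begin

text \<open>The row of \<open>v\<close> bounds \<open>(lam - \<alpha> * deg v) * x v\<close> by
  \<open>1 - \<alpha>\<close> times the weight on \<open>S - {v}\<close> plus the weight outside
  \<open>S\<close>. With \<open>k\<close> entries 1 on \<open>S\<close> this bound is
  \<open>Q\<close> up to \<eta>, and \<open>lam - \<alpha> * deg u \<ge> Q - \<eta>\<close>. Hence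
  there is no room for a smaller \<open>S\<close>, for an entry on \<open>S\<close> well below 1, or
  for a missing edge at \<open>S\<close>.\<close>

lemma dominating_set:
  assumes s: "s = Suc k" "k > 0"
    and Q: "Q = (1 - \<alpha>) * (real k / \<alpha> - 1)"
    and \<eta>: "\<eta> = \<alpha> * (1 - \<alpha>) / (4 * (2 + Q))"
    and lam_ge: "\<alpha> * (real n - 1) + Q - \<eta> \<le> lam"
    and small: "\<And>w. w \<in> verts G - S \<Longrightarrow> x w \<le> \<eta>"
    and outside: "(\<Sum>w\<in>verts G - S. x w) \<le> (1 - \<alpha>) / \<alpha> * real (card S) + \<eta>"
    and "card S < s" and max: "u \<in> verts G" "x u = 1"
  shows "card S = k" "\<And>v. v \<in> S \<Longrightarrow> deg v = n - 1" "u \<in> S"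
proof -
  have "real k / \<alpha> \<ge> 1" using \<alpha> s by (simp add: field_simps)
  then have Q0: "Q \<ge> 0" using Q \<alpha> by simp
  have "\<alpha> * (1 - \<alpha>) < 1 - \<alpha>" "\<alpha> * (1 - \<alpha>) < \<alpha>" "0 < \<alpha> * (1 - \<alpha>)" using \<alpha> by auto
  \<comment> \<open>The value of \<eta> is made for the final contradiction, where
    \<open>\<alpha> * (1 - \<alpha>) \<le> 2 * \<eta> * (2 + Q)\<close> has to fail.\<close>
  then have \<eta>Q: "4 * \<eta> * (2 + Q) = \<alpha> * (1 - \<alpha>)" "\<eta> > 0"
  proof -
    have "2 + Q \<noteq> 0" "2 + Q > 0" using Q0 by auto
    then show "4 * \<eta> * (2 + Q) = \<alpha> * (1 - \<alpha>)" using nonzero_eq_divide_eq[of "4 * (2 + Q)" \<eta> "\<alpha> * (1 - \<alpha>)"] \<eta>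
      by (metis mult.assoc mult.commute mult_eq_0_iff zero_neq_numeral)
    show "\<eta> > 0" unfolding \<eta> using \<open>0 < \<alpha> * (1 - \<alpha>)\<close> \<open>2 + Q > 0\<close> by (intro divide_pos_pos) auto
  qed
  have "0 \<le> \<eta> * Q" using \<eta>Q(2) Q0 by simp
  then have "8 * \<eta> \<le> \<alpha> * (1 - \<alpha>)" unfolding \<eta>Q(1)[symmetric] by (simp add: algebra_simps)
  then have \<eta>8: "8 * \<eta> < \<alpha>" "8 * \<eta> < 1 - \<alpha>"
    using \<open>\<alpha> * (1 - \<alpha>) < 1 - \<alpha>\<close> \<open>\<alpha> * (1 - \<alpha>) < \<alpha>\<close> by linarith+
  have cardk: "card S \<le> k" using assms by simp
  have nb: "(1 - \<alpha>) * (\<Sum>w\<in>nbrs G v. x w) \<le> (1 - \<alpha>) * ((\<Sum>w\<in>S - {v}. x w) + (1 - \<alpha>) / \<alpha> * real (card S) + \<eta>)" for v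
  proof -
    have "(\<Sum>w\<in>nbrs G v. x w) \<le> (\<Sum>w\<in>(verts G - S) \<union> (S - {v}). x w)"
      using finV finS x_nonneg S_subset not_mem_nbrs_self[OF simple, of v] nbrs_subset_verts[of G v]
      by (intro sum_mono2) auto
    also have "\<dots> = (\<Sum>w\<in>verts G - S. x w) + (\<Sum>w\<in>S - {v}. x w)"
      using finV finS by (intro sum.union_disjoint) auto
    finally show ?thesis using outside \<alpha> by (intro mult_left_mono) auto
  qed
  show uS: "u \<in> S"
  proof (rule ccontr)
    assume "u \<notin> S"
    then show False using small[of u] max \<eta>8 \<alpha> by auto
  qed
  have Su: "(\<Sum>w\<in>S - {u}. x w) \<le> real (card S) - 1"
  proof -
    have "card (S - {u}) = card S - 1" "card S > 0" using uS finS by (auto simp: card_gt_0_iff)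
    then show ?thesis using sum_x_le_card[of "S - {u}"] S_subset by (auto simp: of_nat_diff)
  qed
  have deg_le: "deg v + 1 \<le> n" if "v \<in> verts G" for v
    using card_nbrs_less[OF simple that] by simp
  have eq_u: "lam - \<alpha> * real (deg u) \<le> (1 - \<alpha>) * ((\<Sum>w\<in>S - {u}. x w) + (1 - \<alpha>) / \<alpha> * real (card S) + \<eta>)"
    using sub[OF max(1)] max(2) nb[of u] by simp
  \<comment> \<open>With at most \<open>k - 1\<close> vertices in \<open>S\<close> the row of
    \<open>u\<close> allows only
    \<open>Q - (1 - \<alpha>) / \<alpha> + (1 - \<alpha>) * \<eta>\<close>, which is less than
    \<open>Q - \<eta>\<close>.\<close>
  show cS: "card S = k"
  proof (rule ccontr)
    assume "card S \<noteq> k"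
    then have "real (card S) + 1 \<le> real k" using cardk by simp
    have "lam - \<alpha> * real (deg u) \<le> (1 - \<alpha>) * (real (card S) - 1 + (1 - \<alpha>) / \<alpha> * real (card S) + \<eta>)"
      using eq_u Su \<alpha> by (smt (verit) mult_left_mono)
    also have "\<dots> = (1 - \<alpha>) / \<alpha> * real (card S) - (1 - \<alpha>) + (1 - \<alpha>) * \<eta>"
      using \<alpha> by (simp add: field_simps)
    also have "\<dots> \<le> (1 - \<alpha>) / \<alpha> * (real k - 1) - (1 - \<alpha>) + (1 - \<alpha>) * \<eta>"
      using \<alpha> \<open>real (card S) + 1 \<le> real k\<close> by (intro add_right_mono diff_right_mono mult_left_mono) auto
    also have "\<dots> = Q - (1 - \<alpha>) / \<alpha> + (1 - \<alpha>) * \<eta>" using \<alpha> by (simp add: Q field_simps)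
    finally have "lam - \<alpha> * real (deg u) \<le> Q - (1 - \<alpha>) / \<alpha> + (1 - \<alpha>) * \<eta>" .
    moreover have "\<alpha> * real (deg u) \<le> \<alpha> * (real n - 1)" using deg_le[OF max(1)] \<alpha> by simp
    moreover have "(1 - \<alpha>) / \<alpha> \<ge> 1 - \<alpha>"
      using \<alpha> by (simp add: pos_le_divide_eq mult_left_le)
    moreover have "(1 - \<alpha>) * \<eta> \<le> \<eta>" using \<alpha> \<eta>Q by (simp add: algebra_simps)
    ultimately show False using lam_ge \<eta>8 \<eta>Q by linarith
  qed
  fix v assume v: "v \<in> S"
  have Qk: "(1 - \<alpha>) * (real k - 1 + (1 - \<alpha>) / \<alpha> * real k + \<eta>) = Q + (1 - \<alpha>) * \<eta>"
    using \<alpha> by (simp add: Q field_simps)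
  have \<eta>\<alpha>: "(1 - \<alpha>) * \<eta> \<le> \<eta>" using \<alpha> \<eta>Q by (simp add: algebra_simps)
  \<comment> \<open>Every entry on \<open>S\<close> is close to 1: the deficit of \<open>x v\<close>
    also lowers the bound in the row of \<open>u\<close>, where only \<open>2 * \<eta>\<close> can
    be spared.\<close>
  have xv: "(1 - \<alpha>) * (1 - x v) \<le> 2 * \<eta>"
  proof (cases "v = u")
    case True
    then show ?thesis using max \<eta>Q by simp
  next
    case False
    have "(\<Sum>w\<in>S - {u}. x w) = x v + (\<Sum>w\<in>S - {u} - {v}. x w)"
      using v False finS by (intro sum.remove) auto
    moreover have "(\<Sum>w\<in>S - {u} - {v}. x w) \<le> real (card (S - {u} - {v}))"
      using S_subset by (intro sum_x_le_card) auto
    moreover have "card (S - {u} - {v}) + 2 = k"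
      using cS v uS False finS card_Suc_Diff1[of S u] card_Suc_Diff1[of "S - {u}" v] by auto
    ultimately have "(\<Sum>w\<in>S - {u}. x w) \<le> real k - 1 - (1 - x v)" by linarith
    then have "(1 - \<alpha>) * ((\<Sum>w\<in>S - {u}. x w) + (1 - \<alpha>) / \<alpha> * real k + \<eta>)
        \<le> (1 - \<alpha>) * ((real k - 1 - (1 - x v)) + (1 - \<alpha>) / \<alpha> * real k + \<eta>)"
      using \<alpha> by (intro mult_left_mono add_right_mono) auto
    also have "\<dots> = Q + (1 - \<alpha>) * \<eta> - (1 - \<alpha>) * (1 - x v)"
      unfolding Qk[symmetric] by (simp add: algebra_simps)
    finally have "lam - \<alpha> * real (deg u) \<le> Q + (1 - \<alpha>) * \<eta> - (1 - \<alpha>) * (1 - x v)"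
      using eq_u cS by simp
    moreover have "\<alpha> * real (deg u) \<le> \<alpha> * (real n - 1)" using deg_le[OF max(1)] \<alpha> by simp
    ultimately show ?thesis using lam_ge \<eta>\<alpha> by linarith
  qed
  show "deg v = n - 1"
  proof (rule ccontr)
    have vV: "v \<in> verts G" using v S_subset by blast
    assume "deg v \<noteq> n - 1"
    \<comment> \<open>A missing edge raises the coefficient at \<open>v\<close> by \<alpha>, while
      the row of \<open>v\<close> still allows at most \<open>Q + \<eta>\<close>. As
      \<open>x v\<close> is nearly 1 by \<open>xv\<close>, this is impossible; the factor
      \<open>1 - \<alpha>\<close> is inserted below in order to apply \<open>xv\<close>.\<close>
    then have "real (deg v) + 2 \<le> real n" using deg_le[OF vV] by linarith
    then have "\<alpha> * (real (deg v) + 2) \<le> \<alpha> * real n" using \<alpha> by simp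
    then have L: "\<alpha> + Q - \<eta> \<le> lam - \<alpha> * real (deg v)" using lam_ge by (simp add: algebra_simps)
    have "(\<Sum>w\<in>S - {v}. x w) \<le> real (card (S - {v}))"
      using S_subset by (intro sum_x_le_card) auto
    also have "\<dots> = real k - 1" using v cS finS s by (simp add: of_nat_diff)
    finally have "(1 - \<alpha>) * ((\<Sum>w\<in>S - {v}. x w) + (1 - \<alpha>) / \<alpha> * real k + \<eta>) \<le> Q + (1 - \<alpha>) * \<eta>"
      unfolding Qk[symmetric] using \<alpha> by (intro mult_left_mono add_right_mono) auto
    then have "(lam - \<alpha> * real (deg v)) * x v \<le> Q + \<eta>"
      using sub[OF vV] nb[of v] cS \<eta>\<alpha> by simp
    moreover have "(\<alpha> + Q - \<eta>) * x v \<le> (lam - \<alpha> * real (deg v)) * x v"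
      using L x_nonneg[OF vV] by (intro mult_right_mono) auto
    ultimately have "(\<alpha> + Q - \<eta>) * x v \<le> Q + \<eta>" by linarith
    then have "(1 - \<alpha>) * ((\<alpha> + Q - \<eta>) * x v) \<le> (1 - \<alpha>) * (Q + \<eta>)" using \<alpha> by simp
    moreover have "(1 - \<alpha>) * ((\<alpha> + Q - \<eta>) * x v)
        = (1 - \<alpha>) * (\<alpha> + Q - \<eta>) - (\<alpha> + Q - \<eta>) * ((1 - \<alpha>) * (1 - x v))"
      by (simp add: algebra_simps)
    moreover have "(\<alpha> + Q - \<eta>) * ((1 - \<alpha>) * (1 - x v)) \<le> (1 + Q) * (2 * \<eta>)"
    proof (rule mult_mono)
      show "0 \<le> (1 - \<alpha>) * (1 - x v)" using \<alpha> x_le[OF vV] by simp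
    qed (use xv \<alpha> Q0 \<eta>Q(2) in linarith)+
    ultimately have "(1 - \<alpha>) * \<alpha> \<le> 2 * \<eta> * (1 + Q) + 2 * ((1 - \<alpha>) * \<eta>)"
      by (simp add: algebra_simps)
    also have "\<dots> \<le> 2 * \<eta> * (2 + Q)" using \<eta>\<alpha> by (simp add: algebra_simps)
    also have "\<dots> < 4 * \<eta> * (2 + Q)" using \<eta>Q(2) Q0 by simp
    finally show False using \<eta>Q(1) by (simp add: mult.commute)
  qed
qed

end

section \<open>Bounds uniform in all graphs of large order\<close>

text \<open>Order of choice: \<epsilon> makes one term of \<open>entry_le\<close> at most
  \<open>\<eta> / 2\<close>, then \<open>M\<close> is taken large for this \<epsilon>, and finally
  \<open>N\<close> makes the term with \<open>M\<close> at most \<open>\<eta> / 2\<close>. None of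
  them depends on the graph.\<close>

lemma eventually_entries_outside_small:
  fixes s t :: nat and \<alpha> \<eta> :: real
  assumes "0 < \<alpha>" "\<alpha> < 1" "\<eta> > 0"
  shows "\<forall>\<^sub>F N in sequentially. \<forall>(G :: 'a ugraph) lam x. sub_eigenvector G s t \<alpha> lam x \<longrightarrow> card (verts G) = N
    \<longrightarrow> (\<forall>w\<in>verts G - bipartite_free_graph.S G s. x w \<le> \<eta>)"
proof -
  \<comment> \<open>\<open>D\<close> and \<open>C\<close> are the \<delta> and \<open>c\<close> of
    the locale, which depend only on \<open>s\<close> and \<alpha>.\<close>
  define D where "D = 1 / (real s + 1)"
  define C where "C = 2 * (1 - \<alpha>) / (\<alpha> * D)"
  have "D > 0" by (simp add: D_def)
  have "C > 0" using assms \<open>D > 0\<close> by (simp add: C_def)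
  define \<epsilon> where "\<epsilon> = min (1 / 2) (\<eta> / (2 * C\<^sup>2))"
  have \<epsilon>: "0 < \<epsilon>" "\<epsilon> \<le> 1 / 2" using assms \<open>C > 0\<close> by (auto simp: \<epsilon>_def)
  have "\<epsilon> \<le> \<eta> / (2 * C\<^sup>2)" by (simp add: \<epsilon>_def)
  then have C\<epsilon>: "C\<^sup>2 * \<epsilon> \<le> \<eta> / 2" using \<open>C > 0\<close> by (simp add: field_simps)
  obtain M0 :: nat where "real s / \<epsilon> \<le> real M0" using real_arch_simple by blast
  then have M: "real s \<le> real (Suc M0) * \<epsilon>" "Suc M0 > 0" using \<epsilon> by (auto simp: field_simps)
  define M where "M = Suc M0"
  have "\<forall>\<^sub>F N in sequentially. 2 / D \<le> real N" "\<forall>\<^sub>F N in sequentially. 2 * C * real M / \<eta> \<le> real N"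
    using filterlim_real_sequentially by (simp_all add: filterlim_at_top)
  moreover have "\<forall>\<^sub>F N in sequentially. M * ((t - 1) * (M choose s)) < N"
    by (rule eventually_gt_at_top)
  ultimately show ?thesis
  proof eventually_elim
    case (elim N)
    show ?case
    proof (intro allI impI ballI)
      fix G :: "'a ugraph" and lam x w
      assume sv: "sub_eigenvector G s t \<alpha> lam x" and N: "card (verts G) = N"
        and w: "w \<in> verts G - bipartite_free_graph.S G s"
      interpret sub_eigenvector G s t \<alpha> lam x by fact
      have [simp]: "\<delta> = D" "c = C" by (simp_all add: \<delta>_def D_def c_def C_def)
      have D2: "2 \<le> D * real N" using elim(1) \<open>D > 0\<close> by (simp add: field_simps)
      then have "real N > 0" using \<open>D > 0\<close> by (metis mult_zero_right not_numeral_le_zero of_nat_0_le_iff order_le_less)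
      have "x w \<le> c * real M / real n + c\<^sup>2 * \<epsilon>"
        using w D2 \<epsilon> M elim(3) N by (intro entry_le[where M = M]) (auto simp: M_def)
      also have "c * real M / real n \<le> \<eta> / 2"
        using elim(2) \<open>real N > 0\<close> assms by (simp add: N field_simps)
      finally show "x w \<le> \<eta>" using C\<epsilon> by simp
    qed
  qed
qed

text \<open>Divide \<open>sum_outside_le\<close> by \<open>q\<close>, which is at least
  \<open>(\<alpha> - 2 * \<epsilon>) * n\<close>. The error \<open>\<alpha> * \<eta>\<close> is
  spent in two halves: on the difference between \<open>q\<close> and \<open>\<alpha> * n\<close>,
  and on the vertices of large degree outside \<open>S\<close>.\<close>

lemma eventually_sum_outside_le:
  fixes s t :: nat and \<alpha> \<eta> :: real
  assumes "0 < \<alpha>" "\<alpha> < 1" "\<eta> > 0" "s > 0"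
  shows "\<forall>\<^sub>F N in sequentially. \<forall>(G :: 'a ugraph) lam x. sub_eigenvector G s t \<alpha> lam x \<longrightarrow> card (verts G) = N
    \<longrightarrow> card (bipartite_free_graph.S G s) < s
      \<and> (\<Sum>w\<in>verts G - bipartite_free_graph.S G s. x w)
         \<le> (1 - \<alpha>) / \<alpha> * real (card (bipartite_free_graph.S G s)) + \<eta>"
proof -
  define D where "D = 1 / (real s + 1)"
  have "D > 0" by (simp add: D_def)
  \<comment> \<open>\<open>K\<close> bounds the right-hand side of the claim, and \<epsilon> is
    chosen such that the first loss \<open>2 * \<epsilon> * K\<close> is
    \<open>\<alpha> * \<eta> / 2\<close>.\<close>
  define K where "K = real s / \<alpha> + \<eta>"
  have "K > 0" using assms by (simp add: K_def add_pos_pos)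
  define \<epsilon> where "\<epsilon> = \<alpha> * \<eta> / (4 * K)"
  have \<epsilon>: "0 < \<epsilon>" "4 * \<epsilon> * K = \<alpha> * \<eta>" using assms \<open>K > 0\<close> by (auto simp: \<epsilon>_def)
  have "4 * \<epsilon> * \<eta> \<le> 4 * \<epsilon> * K" using \<epsilon>(1) assms by (intro mult_left_mono) (auto simp: K_def)
  then have \<epsilon>\<alpha>: "4 * \<epsilon> \<le> \<alpha>" using assms(3) by (simp add: \<epsilon>(2))
  obtain M0 :: nat where "real s / \<epsilon> \<le> real M0" using real_arch_simple by blast
  then have M: "real s \<le> real (Suc M0) * \<epsilon>" "Suc M0 > 0" using \<epsilon> by (auto simp: field_simps)
  define M where "M = Suc M0"
  \<comment> \<open>The second half. The bound for single entries has to be chosen after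
    \<open>M\<close>, hence after \<epsilon>.\<close>
  define \<eta>' where "\<eta>' = \<alpha> * \<eta> / (2 * real M)"
  have \<eta>': "\<eta>' > 0" "real M * \<eta>' = \<alpha> * \<eta> / 2"
    using assms M(2) unfolding M_def[symmetric] by (auto simp: \<eta>'_def)
  have "\<forall>\<^sub>F N in sequentially. real t / D \<le> real N" "\<forall>\<^sub>F N in sequentially. \<alpha> / \<epsilon> \<le> real N"
    using filterlim_real_sequentially by (simp_all add: filterlim_at_top)
  moreover have "\<forall>\<^sub>F N in sequentially. M * ((t - 1) * (M choose s)) < N"
    by (rule eventually_gt_at_top)
  moreover note eventually_entries_outside_small[OF assms(1,2) \<eta>'(1), of s t, where 'a = 'a]
  ultimately show ?thesis
  proof eventually_elim
    case (elim N)
    show ?case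
    proof (intro allI impI ballI conjI)
      fix G :: "'a ugraph" and lam x
      assume sv: "sub_eigenvector G s t \<alpha> lam x" and N: "card (verts G) = N"
      interpret sub_eigenvector G s t \<alpha> lam x by fact
      have [simp]: "\<delta> = D" by (simp add: \<delta>_def D_def)
      show card: "card S < s" using elim(1) \<open>D > 0\<close> N by (intro card_S_less) (simp add: field_simps)
      define \<Sigma> where "\<Sigma> = (\<Sum>w\<in>verts G - S. x w)"
      define q where "q = \<alpha> * (real n - 1) - \<epsilon> * real n"
      have "real N > 0" using elim(3) by simp
      have small: "x w \<le> \<eta>'" if "w \<in> verts G - S" for w
        using elim(4) sv N that by blast
      have le: "q * \<Sigma> \<le> ((1 - \<alpha>) * real (card S) + real M * \<eta>') * real n"
        unfolding \<Sigma>_def using small \<eta>'(1) M elim(3) N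
        by (intro sum_outside_le[where \<epsilon> = \<epsilon>]) (auto simp: q_def M_def)
      have "\<alpha> \<le> \<epsilon> * real N" using elim(2) \<epsilon>(1) by (simp add: field_simps)
      then have q: "(\<alpha> - 2 * \<epsilon>) * real N \<le> q" by (simp add: q_def N algebra_simps)
      moreover have "\<Sigma> \<ge> 0" unfolding \<Sigma>_def by (intro sum_x_nonneg) auto
      ultimately have "(\<alpha> - 2 * \<epsilon>) * real N * \<Sigma> \<le> ((1 - \<alpha>) * real (card S) + real M * \<eta>') * real N"
        using le N by (meson mult_right_mono order_trans)
      then have "(\<alpha> - 2 * \<epsilon>) * \<Sigma> \<le> (1 - \<alpha>) * real (card S) + \<alpha> * \<eta> / 2"
        using \<open>real N > 0\<close> by (simp add: \<eta>'(2) mult.assoc mult.left_commute[of _ "real N"] mult.commute[of _ "real N"])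
      also have "\<dots> \<le> (\<alpha> - 2 * \<epsilon>) * ((1 - \<alpha>) / \<alpha> * real (card S) + \<eta>)"
      proof -
        have "(1 - \<alpha>) / \<alpha> * real (card S) \<le> 1 / \<alpha> * real s"
          using assms card by (intro mult_mono divide_right_mono) auto
        then have "(1 - \<alpha>) / \<alpha> * real (card S) + \<eta> \<le> K" by (simp add: K_def)
        then have "2 * \<epsilon> * ((1 - \<alpha>) / \<alpha> * real (card S) + \<eta>) \<le> 2 * \<epsilon> * K"
          using \<epsilon>(1) by (intro mult_left_mono) auto
        moreover have "\<alpha> * ((1 - \<alpha>) / \<alpha> * real (card S) + \<eta>) = (1 - \<alpha>) * real (card S) + \<alpha> * \<eta>"
          using assms by (simp add: field_simps)
        ultimately show ?thesis unfolding left_diff_distrib using \<epsilon>(2) by linarith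
      qed
      finally show "(\<Sum>w\<in>verts G - S. x w) \<le> (1 - \<alpha>) / \<alpha> * real (card S) + \<eta>"
        unfolding \<Sigma>_def[symmetric] using \<epsilon>\<alpha> \<epsilon>(1) by simp
    qed
  qed
qed

lemma eventually_dominating_set:
  fixes k t :: nat and \<alpha> Q \<eta> :: real
  assumes "0 < \<alpha>" "\<alpha> < 1" "k > 0"
    and Q: "Q = (1 - \<alpha>) * (real k / \<alpha> - 1)"
    and \<eta>: "\<eta> = \<alpha> * (1 - \<alpha>) / (4 * (2 + Q))"
  shows "\<forall>\<^sub>F N in sequentially. \<forall>(G :: 'a ugraph) lam x u. sub_eigenvector G (Suc k) t \<alpha> lam x \<longrightarrow>
    card (verts G) = N \<longrightarrow> \<alpha> * (real N - 1) + Q - \<eta> \<le> lam \<longrightarrow> u \<in> verts G \<longrightarrow> x u = 1 \<longrightarrow>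
    (\<exists>S \<subseteq> verts G. card S = k \<and> u \<in> S \<and> (\<forall>v\<in>S. card (nbrs G v) = N - 1))"
proof -
  have "real k / \<alpha> \<ge> 1" using assms by (simp add: field_simps)
  then have Q0: "Q \<ge> 0" using Q assms by simp
  then have "\<eta> > 0" unfolding \<eta> using assms(1,2) by (intro divide_pos_pos mult_pos_pos) auto
  have "\<forall>\<^sub>F N in sequentially. \<forall>(G :: 'a ugraph) lam x. sub_eigenvector G (Suc k) t \<alpha> lam x \<longrightarrow> card (verts G) = N
    \<longrightarrow> card (bipartite_free_graph.S G (Suc k)) < Suc k
      \<and> (\<Sum>w\<in>verts G - bipartite_free_graph.S G (Suc k). x w)
         \<le> (1 - \<alpha>) / \<alpha> * real (card (bipartite_free_graph.S G (Suc k))) + \<eta>"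
    using assms \<open>\<eta> > 0\<close> by (intro eventually_sum_outside_le) auto
  moreover have "\<forall>\<^sub>F N in sequentially. \<forall>(G :: 'a ugraph) lam x. sub_eigenvector G (Suc k) t \<alpha> lam x \<longrightarrow>
    card (verts G) = N \<longrightarrow> (\<forall>w\<in>verts G - bipartite_free_graph.S G (Suc k). x w \<le> \<eta>)"
    using assms \<open>\<eta> > 0\<close> by (intro eventually_entries_outside_small) auto
  ultimately show ?thesis
  proof eventually_elim
    case (elim N)
    show ?case
    proof (intro allI impI)
      fix G :: "'a ugraph" and lam x u
      assume sv: "sub_eigenvector G (Suc k) t \<alpha> lam x" and N: "card (verts G) = N"
        and lam_ge: "\<alpha> * (real N - 1) + Q - \<eta> \<le> lam" and u: "u \<in> verts G" "x u = 1"
      interpret sub_eigenvector G "Suc k" t \<alpha> lam x by fact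
      have *: "card S < Suc k" "(\<Sum>w\<in>verts G - S. x w) \<le> (1 - \<alpha>) / \<alpha> * real (card S) + \<eta>"
        "\<And>w. w \<in> verts G - S \<Longrightarrow> x w \<le> \<eta>" using elim sv N by blast+
      have "\<alpha> * (real n - 1) + Q - \<eta> \<le> lam" using lam_ge N by simp
      note D = dominating_set[OF refl \<open>k > 0\<close> Q \<eta> this *(3,2,1) u]
      show "\<exists>S \<subseteq> verts G. card S = k \<and> u \<in> S \<and> (\<forall>v\<in>S. card (nbrs G v) = N - 1)"
        using D N S_subset by (intro exI[of _ S]) simp
    qed
  qed
qed

section \<open>The largest root and the comparison vector\<close>

lemma finite_quadratic_roots:
  fixes p q d :: real
  shows "finite {x. (x - p) * (x - q) = d}"
proof -
  have "{x. (x - p) * (x - q) = d} = {x. poly [:p * q - d, - (p + q), 1:] x = 0}"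
    by (auto simp: algebra_simps)
  then show ?thesis using poly_roots_finite[of "[:p * q - d, - (p + q), 1:]"] by simp
qed

lemma exists_quadratic_root_ge:
  fixes p q d y :: real
  assumes "(y - p) * (y - q) \<le> d"
  shows "\<exists>x\<ge>y. (x - p) * (x - q) = d"
proof -
  \<comment> \<open>At \<open>b\<close> one factor is at least 1 and the other at least
    \<open>\<bar>d\<bar>\<close>, so the intermediate value theorem applies on
    \<open>{y..b}\<close>.\<close>
  define b where "b = max y (max p q + \<bar>d\<bar> + 1)"
  have "1 * \<bar>d\<bar> \<le> (b - p) * (b - q)" by (intro mult_mono) (auto simp: b_def)
  then have "d \<le> (b - p) * (b - q)" by simp
  moreover have "continuous_on {y..b} (\<lambda>x. (x - p) * (x - q))" by (intro continuous_intros)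
  moreover have "y \<le> b" by (simp add: b_def)
  ultimately show ?thesis
    using IVT'[of "\<lambda>x. (x - p) * (x - q)" y d b] assms by auto
qed

text \<open>This is the characteristic equation of the quotient matrix of the extremal graph for its
  dominating clique and the remainder: two diagonal entries on the left, the product of the
  off-diagonal ones on the right.\<close>

lemma f_alpha_eq_0_iff:
  "f_alpha s t n \<alpha> x = 0 \<longleftrightarrow>
    (x - (\<alpha> * (real n - real s + 1) + real s - 2)) * (x - (\<alpha> * (real s - 1) + real t - 1))
      = (1 - \<alpha>)\<^sup>2 * (real s - 1) * (real n - real s + 1)"
  unfolding f_alpha_def power2_eq_square by (auto simp: algebra_simps)

text \<open>Where \<open>f_alpha\<close> is nonpositive there is a root to the right; this turns
  test points into lower bounds.\<close>

lemma largest_root_ge: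
  assumes "(y - (\<alpha> * (real n - real s + 1) + real s - 2)) * (y - (\<alpha> * (real s - 1) + real t - 1))
      \<le> (1 - \<alpha>)\<^sup>2 * (real s - 1) * (real n - real s + 1)"
  shows "y \<le> largest_root (f_alpha s t n \<alpha>)"
proof -
  obtain x where x: "x \<ge> y" "f_alpha s t n \<alpha> x = 0"
    using exists_quadratic_root_ge[OF assms] by (auto simp: f_alpha_eq_0_iff)
  moreover have "finite {x. f_alpha s t n \<alpha> x = 0}"
    using finite_quadratic_roots by (simp add: f_alpha_eq_0_iff)
  ultimately have "x \<le> largest_root (f_alpha s t n \<alpha>)" unfolding largest_root_def by simp
  then show ?thesis using x(1) by simp
qed

lemma largest_root_eq:
  fixes \<alpha> :: real and s t n :: nat
  assumes "s \<ge> 1" "n \<ge> s"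
  defines "\<rho> \<equiv> largest_root (f_alpha s t n \<alpha>)"
  shows "(\<rho> - (\<alpha> * (real n - real s + 1) + real s - 2)) * (\<rho> - (\<alpha> * (real s - 1) + real t - 1))
      = (1 - \<alpha>)\<^sup>2 * (real s - 1) * (real n - real s + 1)"
proof -
  have "0 \<le> (1 - \<alpha>)\<^sup>2 * (real s - 1) * (real n - real s + 1)" using assms(1,2) by simp
  then have "{x. f_alpha s t n \<alpha> x = 0} \<noteq> {}"
    using exists_quadratic_root_ge[of "\<alpha> * (real n - real s + 1) + real s - 2"
        "\<alpha> * (real n - real s + 1) + real s - 2" "\<alpha> * (real s - 1) + real t - 1"]
    unfolding f_alpha_eq_0_iff by fastforce
  moreover have "finite {x. f_alpha s t n \<alpha> x = 0}"
    using finite_quadratic_roots by (simp add: f_alpha_eq_0_iff)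
  ultimately have "\<rho> \<in> {x. f_alpha s t n \<alpha> x = 0}"
    unfolding \<rho>_def largest_root_def by (rule Max_in[rotated])
  then show ?thesis by (simp add: f_alpha_eq_0_iff)
qed

text \<open>At the test point the two factors are \<open>e\<close> and
  \<open>\<alpha> * n + d\<close>. The coefficient of \<open>n\<close> in their product falls short
  of the one on the right by \<open>\<alpha> * \<eta>\<close>, which outweighs the constant terms
  for large \<open>n\<close>.\<close>

lemma eventually_largest_root_ge:
  fixes k t :: nat and \<alpha> \<eta> :: real
  assumes "0 < \<alpha>" "\<alpha> < 1" "\<eta> > 0"
  shows "\<forall>\<^sub>F n in sequentially.
    \<alpha> * (real n - 1) + (1 - \<alpha>) * (real k / \<alpha> - 1) - \<eta> \<le> largest_root (f_alpha (Suc k) t n \<alpha>)"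
proof -
  define d where "d = (1 - \<alpha>) * (real k / \<alpha> - 1) - \<eta> - \<alpha> - (\<alpha> * real k + real t - 1)"
  define e where "e = (1 - \<alpha>)\<^sup>2 * real k / \<alpha> - \<eta>"
  have "\<forall>\<^sub>F n in sequentially. (e * d + (1 - \<alpha>)\<^sup>2 * real k * real k) / (\<alpha> * \<eta>) \<le> real n"
    using filterlim_real_sequentially by (simp add: filterlim_at_top)
  then show ?thesis
  proof eventually_elim
    case (elim n)
    define y where "y = \<alpha> * (real n - 1) + (1 - \<alpha>) * (real k / \<alpha> - 1) - \<eta>"
    have 1: "y - (\<alpha> * (real n - real (Suc k) + 1) + real (Suc k) - 2) = e"
      unfolding y_def e_def using assms(1) by (simp add: field_simps power2_eq_square)
    have 2: "y - (\<alpha> * (real (Suc k) - 1) + real t - 1) = \<alpha> * real n + d"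
      unfolding y_def d_def by (simp add: algebra_simps)
    have "e * d + (1 - \<alpha>)\<^sup>2 * real k * real k \<le> \<alpha> * \<eta> * real n"
      using elim assms by (simp add: field_simps)
    moreover have "e * \<alpha> = (1 - \<alpha>)\<^sup>2 * real k - \<alpha> * \<eta>"
      unfolding e_def using assms(1) by (simp add: field_simps)
    then have "e * \<alpha> * real n = (1 - \<alpha>)\<^sup>2 * real k * real n - \<alpha> * \<eta> * real n"
      by (simp add: left_diff_distrib)
    ultimately have "e * (\<alpha> * real n + d) \<le> (1 - \<alpha>)\<^sup>2 * (real (Suc k) - 1) * (real n - real (Suc k) + 1)"
      by (simp add: algebra_simps)
    then show ?case using largest_root_ge[of y \<alpha> n "Suc k" t] unfolding y_def[symmetric] 1 2 by simp
  qed
qed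

text \<open>The root grows linearly. With \<open>C = \<alpha> * k + r\<close> this makes the entry
  \<open>w\<close> of the comparison vector positive.\<close>

lemma eventually_largest_root_gt_const:
  fixes k t :: nat and \<alpha> C :: real
  assumes "0 < \<alpha>" "\<alpha> < 1"
  shows "\<forall>\<^sub>F n in sequentially. C < largest_root (f_alpha (Suc k) t n \<alpha>)"
proof -
  have "\<forall>\<^sub>F n in sequentially. (C + 1 + \<alpha> - (1 - \<alpha>) * (real k / \<alpha> - 1) + 1) / \<alpha> \<le> real n"
    using filterlim_real_sequentially by (simp add: filterlim_at_top)
  moreover have "\<forall>\<^sub>F n in sequentially.
      \<alpha> * (real n - 1) + (1 - \<alpha>) * (real k / \<alpha> - 1) - 1 \<le> largest_root (f_alpha (Suc k) t n \<alpha>)"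
    using assms by (intro eventually_largest_root_ge) auto
  ultimately show ?thesis
  proof eventually_elim
    case (elim n)
    then have "C + 1 + \<alpha> - (1 - \<alpha>) * (real k / \<alpha> - 1) + 1 \<le> \<alpha> * real n" using assms by (simp add: field_simps)
    then show ?case using elim(2) by (simp add: algebra_simps)
  qed
qed

text \<open>A set \<open>S\<close> of \<open>k\<close> dominating vertices. The comparison vector is \<open>w\<close> on \<open>S\<close> and \<open>1\<close> elsewhere,
  where \<open>w\<close> is chosen such that the row of a vertex outside \<open>S\<close> with \<open>r\<close> neighbours outside \<open>S\<close>
  gives exactly \<open>\<rho>\<close>; the quadratic equation for \<open>\<rho>\<close> says that so do the rows of \<open>S\<close>.\<close>

locale dominated_graph =
  fixes G :: "'a ugraph" and S :: "'a set" and k r :: nat and \<alpha> \<rho> w :: real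
  assumes simple: "simple_graph G"
    and S: "S \<subseteq> verts G" "card S = k" "k > 0"
    and dominating: "\<And>v. v \<in> S \<Longrightarrow> nbrs G v = verts G - {v}"
    and degree_le: "\<And>v. v \<in> verts G - S \<Longrightarrow> card (nbrs G v - S) \<le> r"
    and \<alpha>: "0 < \<alpha>" "\<alpha> < 1"
    and root: "(\<rho> - (\<alpha> * (real (card (verts G)) - real k) + real k - 1)) * (\<rho> - (\<alpha> * real k + real r))
      = (1 - \<alpha>)\<^sup>2 * real k * (real (card (verts G)) - real k)"
    and \<rho>: "\<rho> > \<alpha> * real k + real r"
    and w: "w = (\<rho> - (\<alpha> * real k + real r)) / ((1 - \<alpha>) * real k)"
begin

section \<open>The matrix applied to the comparison vector\<close>

definition y :: "'a \<Rightarrow> real" where "y u = (if u \<in> S then w else 1)"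

definition Ay :: "'a \<Rightarrow> real" where
  "Ay u = \<alpha> * real (card (nbrs G u)) * y u + (1 - \<alpha>) * (\<Sum>v\<in>nbrs G u. y v)"

lemmas finV = finite_verts[OF simple]

lemma finS: "finite S"
  using S finV finite_subset by blast

lemma w_pos: "w > 0"
  using \<rho> \<alpha> S by (simp add: w)

lemma y_pos: "y u > 0"
  using w_pos by (simp add: y_def)

lemma k_le: "k \<le> card (verts G)"
  using S finV by (metis card_mono)

lemma Ay_dominating:
  assumes "u \<in> S"
  shows "Ay u = \<rho> * y u"
proof -
  let ?N = "real (card (verts G)) - real k"
  have u: "u \<in> verts G" using assms S by blast
  have "nbrs G u = (verts G - S) \<union> (S - {u})" using dominating[OF assms] S assms by auto
  then have "(\<Sum>v\<in>nbrs G u. y v) = (\<Sum>v\<in>verts G - S. y v) + (\<Sum>v\<in>S - {u}. y v)"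
    using finV finS by (simp only:) (rule sum.union_disjoint; auto)
  also have "\<dots> = ?N + (real k - 1) * w"
    using assms S finV finS k_le by (simp add: y_def card_Diff_subset of_nat_diff)
  finally have *: "(\<Sum>v\<in>nbrs G u. y v) = ?N + (real k - 1) * w" .
  have "card (nbrs G u) = card (verts G) - 1" using dominating[OF assms] u finV by simp
  then have d: "real (card (nbrs G u)) = ?N + real k - 1" using k_le S by (simp add: of_nat_diff)
  \<comment> \<open>The equation \<open>root\<close>, with its second factor expressed by
    \<open>w\<close>.\<close>
  have "(1 - \<alpha>) * real k * ((\<rho> - (\<alpha> * ?N + real k - 1)) * w) = (1 - \<alpha>) * real k * ((1 - \<alpha>) * ?N)"
    using root \<alpha> S by (simp add: w power2_eq_square mult_ac)
  then have "(\<rho> - (\<alpha> * ?N + real k - 1)) * w = (1 - \<alpha>) * ?N" using \<alpha> S by simp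
  then show ?thesis using assms unfolding Ay_def * d by (simp add: y_def algebra_simps)
qed

lemma nbrs_outside:
  assumes "u \<in> verts G - S"
  shows "S \<subseteq> nbrs G u"
  using assms dominating nbrs_sym[OF simple] S by blast

text \<open>A missing neighbour outside \<open>S\<close> costs \<alpha> in the degree term and
  \<open>1 - \<alpha>\<close> in the sum, hence exactly 1.\<close>

lemma Ay_outside:
  assumes "u \<in> verts G - S"
  shows "Ay u = \<rho> - (real r - real (card (nbrs G u - S)))"
proof -
  have N: "nbrs G u = (nbrs G u - S) \<union> S" using nbrs_outside[OF assms] by blast
  have fin: "finite (nbrs G u)" by (rule finite_nbrs[OF simple])
  have "(\<Sum>v\<in>nbrs G u. y v) = (\<Sum>v\<in>nbrs G u - S. y v) + (\<Sum>v\<in>S. y v)"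
    using nbrs_outside[OF assms] fin by (rule sum.subset_diff)
  also have "\<dots> = real (card (nbrs G u - S)) + real k * w"
    using S by (simp add: y_def)
  finally have *: "(\<Sum>v\<in>nbrs G u. y v) = real (card (nbrs G u - S)) + real k * w" .
  have "card (nbrs G u) = card (nbrs G u - S) + k"
    using nbrs_outside[OF assms] fin finS S by (metis card_Diff_subset card_mono le_add_diff_inverse2)
  moreover have "(1 - \<alpha>) * (real k * w) = \<rho> - (\<alpha> * real k + real r)" using \<alpha> S by (simp add: w)
  ultimately show ?thesis using assms unfolding Ay_def * by (simp add: y_def algebra_simps)
qed

lemma Ay_le: "u \<in> verts G \<Longrightarrow> Ay u \<le> \<rho> * y u"
  using Ay_dominating Ay_outside degree_le by (cases "u \<in> S") (force simp: y_def)+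

text \<open>Symmetry of the matrix: pairing \<open>y\<close> with the image of \<open>x\<close>
  equals pairing \<open>x\<close> with the image of \<open>y\<close>.\<close>

lemma sum_Ay_swap:
  "(\<Sum>u\<in>verts G. y u * (\<alpha> * real (card (nbrs G u)) * x u + (1 - \<alpha>) * (\<Sum>v\<in>nbrs G u. x v)))
    = (\<Sum>u\<in>verts G. x u * Ay u)"
proof -
  have "(\<Sum>u\<in>verts G. \<Sum>v\<in>nbrs G u \<inter> verts G. y u * x v) = (\<Sum>v\<in>verts G. \<Sum>u\<in>nbrs G v \<inter> verts G. y u * x v)"
    by (rule sum_nbrs_swap[OF simple order_refl order_refl])
  then have "(\<Sum>u\<in>verts G. y u * (\<Sum>v\<in>nbrs G u. x v)) = (\<Sum>u\<in>verts G. x u * (\<Sum>v\<in>nbrs G u. y v))"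
    by (simp add: Int_absorb2 nbrs_subset_verts sum_distrib_left mult.commute)
  then have "(\<Sum>u\<in>verts G. (1 - \<alpha>) * (y u * (\<Sum>v\<in>nbrs G u. x v)))
      = (\<Sum>u\<in>verts G. (1 - \<alpha>) * (x u * (\<Sum>v\<in>nbrs G u. y v)))"
    by (simp add: sum_distrib_left[symmetric])
  then show ?thesis by (simp add: Ay_def distrib_left sum.distrib mult_ac)
qed

section \<open>Comparison with a subeigenvector and the equality case\<close>

context
  fixes x :: "'a \<Rightarrow> real" and lam :: real and u0 :: 'a
  assumes x_nonneg: "\<And>u. u \<in> verts G \<Longrightarrow> 0 \<le> x u" and u0: "u0 \<in> verts G" "x u0 > 0"
    and sub: "\<And>u. u \<in> verts G \<Longrightarrow>
      lam * x u \<le> \<alpha> * real (card (nbrs G u)) * x u + (1 - \<alpha>) * (\<Sum>v\<in>nbrs G u. x v)"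
begin

lemma sum_xy_pos: "0 < (\<Sum>u\<in>verts G. x u * y u)"
  using finV u0 x_nonneg y_pos by (intro sum_pos2[of _ u0]) (auto simp: less_imp_le)

lemma sum_weighted_le: "lam * (\<Sum>u\<in>verts G. x u * y u) \<le> (\<Sum>u\<in>verts G. x u * Ay u)"
proof -
  have "(\<Sum>u\<in>verts G. y u * (lam * x u)) \<le>
      (\<Sum>u\<in>verts G. y u * (\<alpha> * real (card (nbrs G u)) * x u + (1 - \<alpha>) * (\<Sum>v\<in>nbrs G u. x v)))"
    using sub y_pos by (intro sum_mono mult_left_mono) (auto simp: less_imp_le)
  then show ?thesis unfolding sum_Ay_swap by (simp add: sum_distrib_left mult_ac)
qed

text \<open>Pairing with \<open>y\<close> bounds \<open>lam\<close> times the pairing of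
  \<open>x\<close> and \<open>y\<close> by \<rho> times the same positive number.\<close>

lemma sub_eigenvalue_le: "lam \<le> \<rho>"
proof -
  have "(\<Sum>u\<in>verts G. x u * Ay u) \<le> (\<Sum>u\<in>verts G. x u * (\<rho> * y u))"
    using Ay_le x_nonneg by (intro sum_mono mult_left_mono) auto
  also have "\<dots> = \<rho> * (\<Sum>u\<in>verts G. x u * y u)" by (simp add: sum_distrib_left mult_ac)
  finally show ?thesis using sum_weighted_le sum_xy_pos by (meson mult_le_cancel_right_pos order_trans)
qed

text \<open>Equality must hold in every row of both estimates of the pairing. At a vertex
  \<open>v\<close> of too small degree the estimate by \<open>Ay_le\<close> is strict if
  \<open>x v > 0\<close>. If \<open>x v = 0\<close>, the inequality \<open>sub\<close> is strict
  instead, because \<open>v\<close> is adjacent to \<open>u0\<close> in \<open>S\<close>.\<close>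

lemma regular_of_sub_eigenvalue_eq:
  assumes lam: "lam = \<rho>" and "u0 \<in> S" and v: "v \<in> verts G - S"
  shows "card (nbrs G v - S) = r"
proof (rule ccontr)
  assume "card (nbrs G v - S) \<noteq> r"
  then have less: "Ay v < \<rho> * y v" using Ay_outside[OF v] degree_le[OF v] v by (simp add: y_def)
  have u0v: "u0 \<in> nbrs G v" using nbrs_outside v \<open>u0 \<in> S\<close> by blast
  show False
  proof (cases "x v > 0")
    case True
    have "(\<Sum>u\<in>verts G. x u * Ay u) < (\<Sum>u\<in>verts G. x u * (\<rho> * y u))"
      using True v less Ay_le x_nonneg
      by (intro sum_strict_mono_ex1 finV) (auto intro!: mult_left_mono bexI[of _ v])
    also have "\<dots> = \<rho> * (\<Sum>u\<in>verts G. x u * y u)" by (simp add: sum_distrib_left mult_ac)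
    finally show False using sum_weighted_le lam by simp
  next
    case False
    then have xv: "x v = 0" using x_nonneg v by force
    let ?R = "\<lambda>u. \<alpha> * real (card (nbrs G u)) * x u + (1 - \<alpha>) * (\<Sum>v\<in>nbrs G u. x v)"
    have "0 < (\<Sum>v\<in>nbrs G v. x v)"
      using u0 u0v x_nonneg subsetD[OF nbrs_subset_verts[of G v]] finite_nbrs[OF simple]
      by (intro sum_pos2[of _ u0]) auto
    then have "lam * x v < ?R v" using xv \<alpha> by simp
    then have "(\<Sum>u\<in>verts G. y u * (lam * x u)) < (\<Sum>u\<in>verts G. y u * ?R u)"
      using sub y_pos v by (intro sum_strict_mono_ex1 finV) (auto intro!: mult_left_mono bexI[of _ v] simp: less_imp_le)
    also have "\<dots> = (\<Sum>u\<in>verts G. x u * Ay u)" by (rule sum_Ay_swap)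
    also have "\<dots> \<le> (\<Sum>u\<in>verts G. x u * (\<rho> * y u))"
      using Ay_le x_nonneg by (intro sum_mono mult_left_mono) auto
    finally show False using lam by (simp add: mult_ac)
  qed
qed

end

lemma eigenvector_of_regular:
  assumes "\<And>v. v \<in> verts G - S \<Longrightarrow> card (nbrs G v - S) = r" and "u \<in> verts G"
  shows "Ay u = \<rho> * y u"
proof (cases "u \<in> S")
  case True
  then show ?thesis by (rule Ay_dominating)
next
  case False
  then show ?thesis using Ay_outside[of u] assms(1)[of u] assms(2) by (simp add: y_def)
qed

end

section \<open>Regular remainders are unions of cliques\<close>

text \<open>A largest grown subset of \<open>X\<close> is the component of \<open>w\<close> in the
  subgraph on \<open>X\<close>.\<close>

lemma grown_insert_closed:
  assumes "finite X" "w \<in> X"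
  obtains C where "grown G w C" "C \<subseteq> X" "\<And>u v. u \<in> C \<Longrightarrow> v \<in> X \<Longrightarrow> {u, v} \<in> edges G \<Longrightarrow> v \<in> C"
proof -
  have "\<exists>C. (grown G w C \<and> C \<subseteq> X) \<and> (\<forall>D. grown G w D \<and> D \<subseteq> X \<longrightarrow> card D \<le> card C)"
  proof (rule ex_has_greatest_nat[where b = "Suc (card X)"])
    show "grown G w {w} \<and> {w} \<subseteq> X" using assms by (auto intro: grown.single)
    show "\<forall>D. grown G w D \<and> D \<subseteq> X \<longrightarrow> card D < Suc (card X)"
      using assms by (simp add: card_mono less_Suc_eq_le)
  qed
  then obtain C where C: "grown G w C" "C \<subseteq> X"
    and max: "\<And>D. grown G w D \<Longrightarrow> D \<subseteq> X \<Longrightarrow> card D \<le> card C" by blast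
  have "v \<in> C" if "u \<in> C" "v \<in> X" "{u, v} \<in> edges G" for u v
  proof (rule ccontr)
    assume "v \<notin> C"
    then have "card (insert v C) \<le> card C" using C that by (intro max grown.extend) auto
    then show False using \<open>v \<notin> C\<close> grown_finite[OF C(1)] by simp
  qed
  then show ?thesis using C that by blast
qed

text \<open>Handshake lemma: a new vertex adds its degree once at itself and once at its
  neighbours.\<close>

lemma even_sum_degrees:
  assumes G: "simple_graph G" and "finite C"
  shows "even (\<Sum>u\<in>C. card (nbrs G u \<inter> C))"
  using assms(2)
proof (induction C rule: finite_induct)
  case empty
  then show ?case by simp
next
  case (insert v C)
  have "card (nbrs G u \<inter> insert v C) = card (nbrs G u \<inter> C) + (if u \<in> nbrs G v then 1 else 0)" for u
    using insert nbrs_sym[OF G, of u v] by (auto simp: Int_insert_right)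
  then have "(\<Sum>u\<in>C. card (nbrs G u \<inter> insert v C)) = (\<Sum>u\<in>C. card (nbrs G u \<inter> C)) + card (C \<inter> nbrs G v)"
    using insert by (simp add: sum.distrib sum.inter_restrict[symmetric])
  moreover have "nbrs G v \<inter> insert v C = C \<inter> nbrs G v"
    using not_mem_nbrs_self[OF G] by auto
  ultimately show ?case using insert by simp
qed

text \<open>The situation in the equality case. The aim is transitivity of adjacency in
  \<open>G - S\<close>, whose components are then complete graphs on \<open>Suc r\<close>
  vertices.\<close>

locale regular_remainder =
  fixes G :: "'a ugraph" and S :: "'a set" and k r :: nat
  assumes simple: "simple_graph G"
    and S: "S \<subseteq> verts G" "card S = k" "k > 0"
    and dominating: "\<And>v. v \<in> S \<Longrightarrow> nbrs G v = verts G - {v}"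
    and regular: "\<And>v. v \<in> verts G - S \<Longrightarrow> card (nbrs G v - S) = r"
    and r: "r \<ge> k"
    and minor_free: "minor_free (complete_bipartite (Suc k) (Suc r)) G"
begin

definition H :: "'a \<Rightarrow> 'a set" where "H v = nbrs G v - S"

lemma H_regular: "v \<in> verts G - S \<Longrightarrow> card (H v) = r"
  using regular by (simp add: H_def)

lemma H_subset: "H v \<subseteq> verts G - S"
  using nbrs_subset_verts[of G v] by (auto simp: H_def)

lemma H_edge: "u \<in> H v \<Longrightarrow> {v, u} \<in> edges G"
  using mem_nbrs[OF simple] by (auto simp: H_def insert_commute)

lemma H_sym: "v \<notin> S \<Longrightarrow> u \<in> H v \<Longrightarrow> v \<in> H u"
  using nbrs_sym[OF simple] by (auto simp: H_def)

lemma not_mem_H_self: "v \<notin> H v"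
  using not_mem_nbrs_self[OF simple] by (auto simp: H_def)

lemma finite_H: "finite (H v)"
  using finite_nbrs[OF simple] by (simp add: H_def)

lemma finS: "finite S"
  using S finite_verts[OF simple] finite_subset by blast

lemma S_edge: "v \<in> S \<Longrightarrow> u \<in> verts G \<Longrightarrow> u \<noteq> v \<Longrightarrow> {v, u} \<in> edges G"
  using dominating mem_nbrs[OF simple] by (metis Diff_iff insert_commute singletonD)

text \<open>Otherwise contracting \<open>W\<close> to one vertex and adding it to \<open>S\<close> gives the forbidden minor.\<close>

lemma outer_nbrs_le:
  assumes W: "grown G w W" "W \<subseteq> verts G - S" and T: "T \<subseteq> verts G - S - W"
    and attached: "\<And>y. y \<in> T \<Longrightarrow> \<exists>u\<in>W. y \<in> H u"
  shows "card T \<le> r"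
proof (rule ccontr)
  assume "\<not> card T \<le> r"
  then obtain Y where Y: "Y \<subseteq> T" "card Y = Suc r" by (metis not_less_eq_eq obtain_subset_with_card_n)
  have "has_minor G (complete_bipartite (Suc k) (Suc r))"
  proof (rule has_bipartite_minor[OF simple W(1), of S k Y])
    show "{x, y} \<in> edges G" if "x \<in> S" "y \<in> Y" for x y using that Y T by (intro S_edge) auto
    show "\<exists>u\<in>W. {u, y} \<in> edges G" if "y \<in> Y" for y
      using attached[of y] Y that H_edge by blast
  qed (use W T Y S in auto)
  then show False using minor_free by simp
qed

text \<open>The second way of using \<open>S\<close>: one of its vertices joins the larger side.\<close>

lemma not_all_nbrs_attached:
  assumes a: "a \<in> verts G - S" and C: "grown G w C" "C \<subseteq> verts G - S - insert a (H a)"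
    and attached: "\<And>y. y \<in> H a \<Longrightarrow> \<exists>u\<in>C. y \<in> H u"
  shows False
proof -
  obtain h where h: "h \<in> S" using S by (metis card.empty equals0I less_irrefl)
  \<comment> \<open>\<open>a\<close> replaces \<open>h\<close> on the smaller side, which
    \<open>C\<close> will complete, and \<open>h\<close> brings the neighbours of \<open>a\<close>
    up to \<open>Suc r\<close> vertices.\<close>
  have cX: "card (insert a (S - {h})) = k"
    using h a finS S by (simp add: card_Suc_Diff1)
  have "h \<notin> H a" using h by (simp add: H_def)
  then have cY: "card (insert h (H a)) = Suc r" using finite_H H_regular[OF a] by simp
  have "has_minor G (complete_bipartite (Suc k) (Suc r))"
  proof (rule has_bipartite_minor[OF simple C(1) _ _ cX _ cY])
    show "C \<subseteq> verts G" "insert a (S - {h}) \<subseteq> verts G - C" "insert h (H a) \<subseteq> verts G - C"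
      using C a S h H_subset by auto
    show "insert a (S - {h}) \<inter> insert h (H a) = {}"
      using a h H_subset not_mem_H_self by auto
    show "{x, y} \<in> edges G" if xy: "x \<in> insert a (S - {h})" "y \<in> insert h (H a)" for x y
    proof (cases "x = a")
      case True
      then show ?thesis using xy H_edge[of y a] S_edge[of h a] h a by (auto simp: insert_commute)
    next
      case False
      then show ?thesis using xy H_subset[of a] S h by (intro S_edge) auto
    qed
    show "\<exists>u\<in>C. {u, y} \<in> edges G" if "y \<in> insert h (H a)" for y
    proof (cases "y = h")
      case True
      have "w \<in> C" using grown_mem C by metis
      moreover have "{w, h} \<in> edges G"
        using S_edge[of h w] \<open>w \<in> C\<close> C(2) h by (metis Diff_iff insert_commute subsetD)
      ultimately show ?thesis using True by blast
    next
      case False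
      then show ?thesis using that attached[of y] H_edge by blast
    qed
  qed
  then show False using minor_free by simp
qed

text \<open>Contracting the edge between \<open>u\<close> and \<open>v\<close> gives a vertex with
  the \<open>r - 1\<close> other neighbours of \<open>v\<close> and all of \<open>?D\<close> as
  neighbours, and \<open>outer_nbrs_le\<close> allows \<open>r\<close> in total.\<close>

lemma adjacent_diff_le_1:
  assumes u: "u \<in> verts G - S" and v: "v \<in> H u"
  shows "card (insert u (H u) - insert v (H v)) \<le> 1"
proof -
  have vV: "v \<in> verts G - S" using v H_subset by blast
  have uv: "u \<in> H v" using u v H_sym by blast
  have "u \<noteq> v" using v not_mem_H_self by blast
  let ?D = "insert u (H u) - insert v (H v)"
  have "card ((H v - {u}) \<union> ?D) \<le> r"
  proof (rule outer_nbrs_le[of v "insert u {v}"])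
    show "grown G v (insert u {v})"
      using uv H_edge \<open>u \<noteq> v\<close> by (intro grown.extend[where u = v] grown.single) auto
    show "H v - {u} \<union> ?D \<subseteq> verts G - S - {u, v}"
      using H_subset not_mem_H_self uv by blast
    show "\<exists>w\<in>{u, v}. y \<in> H w" if "y \<in> H v - {u} \<union> ?D" for y
      using that uv by auto
  qed (use u vV in auto)
  moreover have "card ((H v - {u}) \<union> ?D) = card (H v - {u}) + card ?D"
    using finite_H by (intro card_Un_disjoint) auto
  moreover have "card (H v - {u}) + 1 = r"
    using H_regular[OF vV] uv finite_H by (metis Suc_eq_plus1 card_Suc_Diff1)
  ultimately show ?thesis by simp
qed

text \<open>For adjacent \<open>u\<close>, \<open>v\<close> the closed neighbourhood of
  \<open>u\<close> has at most one element outside that of \<open>v\<close>. An induced path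
  \<open>a\<close>, \<open>b\<close>, \<open>c\<close> yields a neighbour \<open>p\<close> of
  \<open>a\<close> for which the closed neighbourhoods of \<open>a\<close> and \<open>p\<close>
  differ in two such elements.\<close>

lemma H_trans_degree_ge_3:
  assumes "r \<ge> 3" and a: "a \<in> verts G - S" and b: "b \<in> H a" and c: "c \<in> H b" and "a \<noteq> c"
  shows "c \<in> H a"
proof (rule ccontr)
  assume ac: "c \<notin> H a"
  let ?M = "\<lambda>v. insert v (H v)"
  have bV: "b \<in> verts G - S" and cV: "c \<in> verts G - S" using b c H_subset by blast+
  have ba: "a \<in> H b" and cb: "b \<in> H c" using H_sym a b c bV by blast+
  have ca: "a \<notin> H c" using H_sym ac cV by blast
  have diff: "x = z" if "u \<in> verts G - S" "v \<in> H u" "x \<in> ?M u - ?M v" "z \<in> ?M u - ?M v" for u v x z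
  proof -
    have "finite (?M u - ?M v)" using finite_H by auto
    then show ?thesis using adjacent_diff_le_1[OF that(1,2)] that(3,4)
      by (metis card_le_Suc0_iff_eq One_nat_def)
  qed
  \<comment> \<open>Otherwise the single vertex \<open>c\<close> is a connected set that avoids
    \<open>a\<close> and is adjacent to all its neighbours.\<close>
  have "H a \<noteq> H c"
  proof
    assume eq: "H a = H c"
    show False
    proof (rule not_all_nbrs_attached[OF a grown.single[of G c]])
      show "{c} \<subseteq> verts G - S - insert a (H a)" using cV ac \<open>a \<noteq> c\<close> by auto
    qed (use eq in auto)
  qed
  moreover have "card (H a) = card (H c)" using H_regular a cV by simp
  ultimately have "\<not> H a \<subseteq> H c" using finite_H by (metis card_subset_eq)
  then obtain p where p: "p \<in> H a" "p \<notin> H c" by blast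
  have pV: "p \<in> verts G - S" using p H_subset by blast
  have pc: "p \<noteq> c" "p \<noteq> a" "p \<noteq> b" using p ac not_mem_H_self cb by auto
  have aD: "a \<in> ?M b - ?M c" using ba ca \<open>a \<noteq> c\<close> by auto
  have "p \<notin> H b"
    using diff[OF bV c aD, of p] p pc by auto
  then have pD: "p \<in> ?M a - ?M b" using p pc by auto
  \<comment> \<open>At least \<open>r\<close> vertices lie in both closed neighbourhoods; apart from
    \<open>a\<close> at least \<open>r - 1 \<ge> 2\<close> remain, and this is where
    \<open>r \<ge> 3\<close> enters.\<close>
  define D where "D = ?M a \<inter> ?M b - {a}"
  have "card (?M a - ?M b) \<le> 1" using adjacent_diff_le_1[OF a b] .
  moreover have "card (?M a) = Suc r" using finite_H not_mem_H_self H_regular[OF a] by simp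
  moreover have "card (?M a) = card (?M a - ?M b) + card (?M a \<inter> ?M b)"
    using finite_H by (metis Int_commute add.commute card_Int_Diff finite_insert)
  moreover have "card (?M a \<inter> ?M b) = Suc (card D)"
    using ba finite_H unfolding D_def by (intro card.remove[of _ a]) auto
  ultimately have "card D \<ge> 2" using \<open>r \<ge> 3\<close> by linarith
  then obtain d e where de: "d \<in> D" "e \<in> D" "d \<noteq> e"
    by (metis One_nat_def Suc_1 card_le_Suc0_iff_eq card.infinite not_less_eq_eq le_zero_eq zero_less_Suc less_le_not_le nat.simps(3))
  \<comment> \<open>As \<open>a\<close> is the one element allowed in \<open>?M b - ?M c\<close>,
    the vertex \<open>d\<close> is adjacent to \<open>c\<close>. Then \<open>a\<close> is also the
    one element allowed in \<open>?M d - ?M c\<close>, so \<open>p\<close> is not adjacent to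
    \<open>d\<close>.\<close>
  have key: "d \<in> ?M a - ?M p" if d: "d \<in> D" for d
  proof -
    have d1: "d \<in> H a" "d \<noteq> a" "d \<in> ?M b" using d by (auto simp: D_def)
    have dV: "d \<in> verts G - S" using d1 H_subset by blast
    have "d \<in> ?M c" using diff[OF bV c aD, of d] d1 by auto
    moreover have "d \<noteq> c" using d1 ac by blast
    ultimately have dc: "d \<in> H c" by blast
    have da: "a \<in> H d" and cd: "c \<in> H d" using d1 dc H_sym a cV by blast+
    have "a \<in> ?M d - ?M c" using da ca \<open>a \<noteq> c\<close> by auto
    then have "p \<notin> ?M d" using diff[OF dV cd, of a p] p pc by auto
    then have "d \<notin> ?M p" using H_sym pV by auto
    then show ?thesis using d1 by auto
  qed
  show False using diff[OF a p(1) key[OF de(1)] key[OF de(2)]] de(3) by simp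
qed

text \<open>In a cycle of length at least four a vertex \<open>b\<close> is avoided by a path between its two
  neighbours, by parity of the degree sum in the component of the remainder.\<close>

lemma H_trans_degree_2:
  assumes "r = 2" and a: "a \<in> verts G - S" and b: "b \<in> H a" and c: "c \<in> H b" and "a \<noteq> c"
  shows "c \<in> H a"
proof (rule ccontr)
  assume ac: "c \<notin> H a"
  have bV: "b \<in> verts G - S" and cV: "c \<in> verts G - S" using b c H_subset by blast+
  have ba: "a \<in> H b" and cb: "b \<in> H c" using H_sym a b c bV by blast+
  have Hb: "H b = {a, c}"
    using H_regular[OF bV] \<open>r = 2\<close> ba c \<open>a \<noteq> c\<close> finite_H[of b]
    by (intro card_seteq[symmetric]) auto
  have "card (H a - {b}) = 1" using H_regular[OF a] \<open>r = 2\<close> b finite_H by simp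
  then obtain p where p: "H a - {b} = {p}" by (auto simp: card_1_singleton_iff)
  then have pa: "p \<in> H a" "p \<noteq> b" and Ha: "H a = {b, p}" using b by auto
  have pV: "p \<in> verts G - S" using pa H_subset by blast
  have "p \<noteq> a" "p \<noteq> c" using pa ac not_mem_H_self by auto
  \<comment> \<open>\<open>C\<close> below is the part reached from \<open>p\<close>, the other
    neighbour of \<open>a\<close>, without passing through \<open>a\<close>, \<open>b\<close> or
    \<open>c\<close>.\<close>
  define X where "X = verts G - S - {a, b, c}"
  have finX: "finite X" using finite_verts[OF simple] by (simp add: X_def)
  have "p \<in> X" using pV pa \<open>p \<noteq> a\<close> \<open>p \<noteq> c\<close> by (simp add: X_def)
  then obtain C where C: "grown G p C" "C \<subseteq> X"
    and closed: "\<And>u v. u \<in> C \<Longrightarrow> v \<in> X \<Longrightarrow> {u, v} \<in> edges G \<Longrightarrow> v \<in> C"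
    using grown_insert_closed[OF finX] by metis
  have pC: "p \<in> C" using C grown_mem by metis
  show False
  proof (cases "\<exists>u\<in>C. c \<in> H u")
    case True
    show False
    proof (rule not_all_nbrs_attached[OF bV C(1)])
      show "C \<subseteq> verts G - S - insert b (H b)" using C Hb by (auto simp: X_def)
      have "a \<in> H p" using H_sym pa a by blast
      then show "\<exists>u\<in>C. y \<in> H u" if "y \<in> H b" for y using that Hb True pC by auto
    qed
  next
    case False
    \<comment> \<open>If \<open>C\<close> has no edge to \<open>c\<close>, its only edge to the
      outside within the remainder is the one from \<open>p\<close> to \<open>a\<close>, so the
      degrees inside \<open>C\<close> have an odd sum.\<close>
    have deg: "card (nbrs G u \<inter> C) = (if u = p then 1 else 2)" if u: "u \<in> C" for u
    proof -
      have uV: "u \<in> verts G - S" using C u by (auto simp: X_def)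
      have "u \<noteq> a" "u \<noteq> c" "u \<noteq> b" using C u by (auto simp: X_def)
      have "b \<notin> H u" using H_sym[of u b] uV Hb \<open>u \<noteq> a\<close> \<open>u \<noteq> c\<close> by auto
      moreover have "c \<notin> H u" using False u by blast
      moreover have "H u \<inter> X \<subseteq> C" using closed u H_edge by blast
      ultimately have sub: "H u - {a} \<subseteq> C" using H_subset[of u] by (auto simp: X_def)
      have "nbrs G u \<inter> C = H u - {a}" using sub C(2) by (auto simp: H_def X_def)
      moreover have "a \<in> H u \<longleftrightarrow> u = p"
        using H_sym[of u a] H_sym[of a u] uV a Ha \<open>u \<noteq> b\<close> by auto
      moreover have "card (H u) = 2" using H_regular[OF uV] \<open>r = 2\<close> by simp
      ultimately show ?thesis by (cases "u = p") (simp_all only: card_Diff_singleton Diff_insert0 Diff_empty, simp_all)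
    qed
    have "finite C" using finX C finite_subset by blast
    then have "even (\<Sum>u\<in>C. card (nbrs G u \<inter> C))" by (rule even_sum_degrees[OF simple])
    moreover have "(\<Sum>u\<in>C. card (nbrs G u \<inter> C)) = 1 + 2 * card (C - {p})"
      using \<open>finite C\<close> pC by (simp add: deg sum.remove[of C p])
    ultimately show False by simp
  qed
qed

lemma H_trans:
  assumes a: "a \<in> verts G - S" and b: "b \<in> H a" and c: "c \<in> H b" and "a \<noteq> c"
  shows "c \<in> H a"
proof -
  have bV: "b \<in> verts G - S" using b H_subset by blast
  have "{a, c} \<subseteq> H b" using H_sym a b c bV by blast
  then have "card {a, c} \<le> r" using H_regular[OF bV] finite_H card_mono by metis
  then have "r = 2 \<or> r \<ge> 3" using \<open>a \<noteq> c\<close> by auto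
  then show ?thesis using H_trans_degree_2 H_trans_degree_ge_3 assms by blast
qed

end

section \<open>The extremal graph\<close>

lemma simple_graph_complete_graph: "simple_graph (complete_graph m)"
  by (auto simp: simple_graph_def complete_graph_def)

lemma simple_graph_copies:
  assumes "simple_graph G"
  shows "simple_graph (copies p G)"
proof -
  have "card (Pair i ` e) = card e" for i :: nat and e :: "'a set"
    by (intro card_image) (auto simp: inj_on_def)
  then show ?thesis using assms by (fastforce simp: simple_graph_def copies_def)
qed

lemma simple_graph_join:
  assumes "simple_graph G" "simple_graph H"
  shows "simple_graph (graph_join G H)"
proof -
  have "card ((Inl :: 'a \<Rightarrow> 'a + 'b) ` e) = card e" for e by (intro card_image) auto
  moreover have "card ((Inr :: 'b \<Rightarrow> 'a + 'b) ` e) = card e" for e by (intro card_image) auto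
  ultimately show ?thesis using assms by (fastforce simp: simple_graph_def graph_join_def)
qed

lemma edge_complete_graph_iff: "{i, j} \<in> edges (complete_graph m) \<longleftrightarrow> i < m \<and> j < m \<and> i \<noteq> j"
  by (auto simp: complete_graph_def card_2_iff doubleton_eq_iff)

lemma edge_copies_iff: "{(a, i), (b, j)} \<in> edges (copies p G) \<longleftrightarrow> a = b \<and> a < p \<and> {i, j} \<in> edges G"
proof
  assume "{(a, i), (b, j)} \<in> edges (copies p G)"
  then obtain c e where e: "{(a, i), (b, j)} = Pair c ` e" "c < p" "e \<in> edges G"
    unfolding copies_def by auto
  then have "a = c" "b = c" by blast+
  moreover from this have "Pair c ` {i, j} = Pair c ` e" using e(1) by simp
  then have "{i, j} = e" by (subst (asm) inj_image_eq_iff) (auto simp: inj_on_def)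
  ultimately show "a = b \<and> a < p \<and> {i, j} \<in> edges G" using e by simp
next
  assume *: "a = b \<and> a < p \<and> {i, j} \<in> edges G"
  then have "{(a, i), (b, j)} = Pair a ` {i, j}" by simp
  then show "{(a, i), (b, j)} \<in> edges (copies p G)" using * unfolding copies_def ugraph.simps by blast
qed

lemma edge_join_Inl_Inl:
  fixes G :: "'a ugraph" and H :: "'b ugraph"
  shows "{Inl u, Inl v} \<in> edges (graph_join G H) \<longleftrightarrow> {u, v} \<in> edges G"
proof
  assume "{Inl u, Inl v} \<in> edges (graph_join G H)"
  then obtain e where e: "({Inl u, Inl v} :: ('a + 'b) set) = Inl ` e" "e \<in> edges G"
    unfolding graph_join_def by (auto simp: doubleton_eq_iff)
  then have "(Inl ` {u, v} :: ('a + 'b) set) = Inl ` e" by simp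
  then have "{u, v} = e" by (subst (asm) inj_image_eq_iff) auto
  then show "{u, v} \<in> edges G" using e by simp
next
  assume "{u, v} \<in> edges G"
  then have "Inl ` {u, v} \<in> edges (graph_join G H)" unfolding graph_join_def ugraph.simps by blast
  then show "{Inl u, Inl v} \<in> edges (graph_join G H)" by simp
qed

lemma edge_join_Inr_Inr:
  fixes G :: "'a ugraph" and H :: "'b ugraph"
  shows "{Inr u, Inr v} \<in> edges (graph_join G H) \<longleftrightarrow> {u, v} \<in> edges H"
proof
  assume "{Inr u, Inr v} \<in> edges (graph_join G H)"
  then obtain e where e: "({Inr u, Inr v} :: ('a + 'b) set) = Inr ` e" "e \<in> edges H"
    unfolding graph_join_def by (auto simp: doubleton_eq_iff)
  then have "(Inr ` {u, v} :: ('a + 'b) set) = Inr ` e" by simp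
  then have "{u, v} = e" by (subst (asm) inj_image_eq_iff) auto
  then show "{u, v} \<in> edges H" using e by simp
next
  assume "{u, v} \<in> edges H"
  then have "Inr ` {u, v} \<in> edges (graph_join G H)" unfolding graph_join_def ugraph.simps by blast
  then show "{Inr u, Inr v} \<in> edges (graph_join G H)" by simp
qed

lemma edge_join_Inl_Inr: "{Inl u, Inr v} \<in> edges (graph_join G H) \<longleftrightarrow> u \<in> verts G \<and> v \<in> verts H"
proof
  assume *: "{Inl u, Inr v} \<in> edges (graph_join G H)"
  have "{Inl u, Inr v} \<noteq> Inl ` e" for e using insertI1[of "Inr v" "{Inl u}"] by (metis Inl_Inr_False imageE insert_commute)
  moreover have "{Inl u, Inr v} \<noteq> Inr ` e" for e by (metis Inl_Inr_False imageE insertI1)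
  ultimately show "u \<in> verts G \<and> v \<in> verts H"
    using * unfolding graph_join_def by (auto simp: doubleton_eq_iff)
next
  assume "u \<in> verts G \<and> v \<in> verts H"
  then show "{Inl u, Inr v} \<in> edges (graph_join G H)" unfolding graph_join_def ugraph.simps by blast
qed

lemma iso_graphI:
  assumes G: "simple_graph G" and H: "simple_graph H" and f: "bij_betw f (verts G) (verts H)"
    and adj: "\<And>u v. u \<in> verts G \<Longrightarrow> v \<in> verts G \<Longrightarrow> {u, v} \<in> edges G \<longleftrightarrow> {f u, f v} \<in> edges H"
  shows "iso_graph G H"
proof -
  have "edges H = (\<lambda>e. f ` e) ` edges G"
  proof (intro equalityI subsetI)
    fix e assume e: "e \<in> edges H"
    then obtain x y where xy: "e = {x, y}" using edges_altdef[OF H] by auto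
    then have "x \<in> verts H" "y \<in> verts H" using edgeD[OF H] e by blast+
    then obtain u v where uv: "u \<in> verts G" "v \<in> verts G" "x = f u" "y = f v"
      using f by (metis bij_betw_imp_surj_on imageE)
    then have "e = f ` {u, v}" "{u, v} \<in> edges G" using adj e xy by auto
    then show "e \<in> (\<lambda>e. f ` e) ` edges G" by blast
  next
    fix e assume "e \<in> (\<lambda>e. f ` e) ` edges G"
    then obtain d where d: "e = f ` d" "d \<in> edges G" by blast
    then obtain u v where "d = {u, v}" using edges_altdef[OF G] by auto
    then show "e \<in> edges H" using d adj[of u v] edgeD[OF G, of u v] by auto
  qed
  then show ?thesis using f unfolding iso_graph_def by blast
qed

lemma iso_graphD:
  assumes G: "simple_graph G" and "iso_graph G H"
  obtains f where "bij_betw f (verts G) (verts H)"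
    "\<And>u v. u \<in> verts G \<Longrightarrow> v \<in> verts G \<Longrightarrow> {u, v} \<in> edges G \<longleftrightarrow> {f u, f v} \<in> edges H"
proof -
  obtain f where f: "bij_betw f (verts G) (verts H)" and E: "edges H = (\<lambda>e. f ` e) ` edges G"
    using assms(2) unfolding iso_graph_def by blast
  have inj: "inj_on f (verts G)" using f by (simp add: bij_betw_def)
  have "{u, v} \<in> edges G \<longleftrightarrow> {f u, f v} \<in> edges H" if "u \<in> verts G" "v \<in> verts G" for u v
  proof
    assume "{u, v} \<in> edges G"
    then have "f ` {u, v} \<in> edges H" unfolding E by (rule imageI)
    then show "{f u, f v} \<in> edges H" by simp
  next
    assume "{f u, f v} \<in> edges H"
    then obtain d where d: "f ` {u, v} = f ` d" "d \<in> edges G" unfolding E by auto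
    have "d \<subseteq> verts G" using G d(2) by (auto simp: simple_graph_def)
    then have "{u, v} = d" using inj_on_image_eq_iff[OF inj, of "{u, v}" d] d(1) that by blast
    then show "{u, v} \<in> edges G" using d by simp
  qed
  then show ?thesis using that f by blast
qed

section \<open>The cliques of the remainder\<close>

context regular_remainder
begin

text \<open>By transitivity this closed neighbourhood is the whole component of \<open>v\<close> in
  \<open>G - S\<close>.\<close>

definition cell :: "'a \<Rightarrow> 'a set" where "cell v = insert v (H v)"

lemma cell_eqI:
  assumes "u \<in> verts G - S" "v \<in> H u"
  shows "cell u = cell v"
proof -
  have sub: "cell v \<subseteq> cell u" if "u \<in> verts G - S" "v \<in> H u" for u v
    using that H_trans[OF that] by (auto simp: cell_def)
  have "v \<in> verts G - S" "u \<in> H v" using assms H_sym H_subset by blast+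
  then show ?thesis using sub assms by blast
qed

lemma cell_eq_iff:
  assumes "u \<in> verts G - S" "v \<in> verts G - S"
  shows "cell u = cell v \<longleftrightarrow> u = v \<or> v \<in> H u"
  using cell_eqI[OF assms(1), of v] by (auto simp: cell_def)

lemma mem_cell_iff:
  assumes "u \<in> verts G - S" "v \<in> verts G - S"
  shows "v \<in> cell u \<longleftrightarrow> cell v = cell u"
  using cell_eq_iff[OF assms] by (auto simp: cell_def)

lemma card_cell: "v \<in> verts G - S \<Longrightarrow> card (cell v) = Suc r"
  using H_regular finite_H not_mem_H_self by (simp add: cell_def)

lemma cell_subset: "v \<in> verts G - S \<Longrightarrow> cell v \<subseteq> verts G - S"
  using H_subset by (auto simp: cell_def)

text \<open>The cells partition \<open>G - S\<close> into cliques of equal size. The isomorphism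
  consists of a numbering \<open>l\<close> of \<open>S\<close>, a numbering \<open>g\<close> of the
  cells and a numbering \<open>h c\<close> of each cell \<open>c\<close>.\<close>

lemma iso_join_cliques:
  "\<exists>p. card (verts G) = k + p * Suc r
    \<and> iso_graph G (graph_join (complete_graph k) (copies p (complete_graph (Suc r))))"
proof -
  define \<Q> where "\<Q> = cell ` (verts G - S)"
  have finO: "finite (verts G - S)" using finite_verts[OF simple] by simp
  then have fin\<Q>: "finite \<Q>" by (simp add: \<Q>_def)
  define p where "p = card \<Q>"
  obtain g where g: "bij_betw g \<Q> {..<p}"
    using fin\<Q> by (metis bij_betw_iff_card card_lessThan finite_lessThan p_def)
  have "\<exists>h. bij_betw h c {..<Suc r}" if "c \<in> \<Q>" for c
  proof -
    obtain v where v: "v \<in> verts G - S" "c = cell v" using \<open>c \<in> \<Q>\<close> by (auto simp: \<Q>_def)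
    then have "finite c" "card c = Suc r" using card_cell finite_H by (auto simp: cell_def)
    then show ?thesis by (metis bij_betw_iff_card card_lessThan finite_lessThan)
  qed
  then obtain h where h: "\<And>c. c \<in> \<Q> \<Longrightarrow> bij_betw (h c) c {..<Suc r}" by metis
  obtain l where l: "bij_betw l S {..<k}"
    using finS S(2) by (metis bij_betw_iff_card card_lessThan finite_lessThan)
  define q where "q v = (g (cell v), h (cell v) v)" for v
  have q: "bij_betw q (verts G - S) ({..<p} \<times> {..<Suc r})"
  proof (rule bij_betw_imageI)
    show "inj_on q (verts G - S)"
    proof (rule inj_onI)
      fix u v assume uv: "u \<in> verts G - S" "v \<in> verts G - S" "q u = q v"
      then have "cell u \<in> \<Q>" "cell v \<in> \<Q>" by (auto simp: \<Q>_def)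
      then have c: "cell u = cell v" using uv(3) g unfolding q_def bij_betw_def inj_on_def by simp
      then have "h (cell u) u = h (cell u) v" using uv(3) by (simp add: q_def)
      moreover have "inj_on (h (cell u)) (cell u)" using h \<open>cell u \<in> \<Q>\<close> by (simp add: bij_betw_def)
      moreover have "u \<in> cell u" "v \<in> cell u" using c by (auto simp: cell_def)
      ultimately show "u = v" by (meson inj_onD)
    qed
    show "q ` (verts G - S) = {..<p} \<times> {..<Suc r}"
    proof (intro equalityI subsetI)
      fix z assume "z \<in> q ` (verts G - S)"
      then obtain v where v: "v \<in> verts G - S" "z = q v" by blast
      then have "cell v \<in> \<Q>" "v \<in> cell v" by (auto simp: \<Q>_def cell_def)
      then have "g (cell v) \<in> {..<p}" "h (cell v) v \<in> {..<Suc r}"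
        using g h by (meson bij_betwE)+
      then show "z \<in> {..<p} \<times> {..<Suc r}" using v by (simp add: q_def)
    next
      fix z assume "z \<in> {..<p} \<times> {..<Suc r}"
      then obtain i j where z: "z = (i, j)" "i \<in> {..<p}" "j \<in> {..<Suc r}" by auto
      obtain c where c: "c \<in> \<Q>" "g c = i" using g z(2) by (metis bij_betw_imp_surj_on imageE)
      obtain v where v: "v \<in> c" "h c v = j" using h[OF c(1)] z(3) by (metis bij_betw_imp_surj_on imageE)
      obtain u where u: "u \<in> verts G - S" "c = cell u" using c by (auto simp: \<Q>_def)
      then have vO: "v \<in> verts G - S" using cell_subset v by blast
      then have "cell v = c" using mem_cell_iff[OF u(1) vO] u v by simp
      then show "z \<in> q ` (verts G - S)" using z c v vO by (auto simp: q_def)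
    qed
  qed
  have "card (verts G - S) = p * Suc r"
    using bij_betw_same_card[OF q] by (simp add: card_cartesian_product)
  moreover have "card (verts G) = card S + card (verts G - S)"
    using S finS finite_verts[OF simple] by (metis add.commute card_Diff_subset card_mono le_add_diff_inverse2)
  ultimately have card: "card (verts G) = k + p * Suc r" using S by simp
  let ?J = "graph_join (complete_graph k) (copies p (complete_graph (Suc r)))"
  define F where "F v = (if v \<in> S then Inl (l v) else Inr (q v))" for v
  have "iso_graph G ?J"
  proof (rule iso_graphI[OF simple, of _ F])
    show "simple_graph ?J"
      by (intro simple_graph_join simple_graph_copies simple_graph_complete_graph)
    have VJ: "verts ?J = Inl ` {..<k} \<union> Inr ` ({..<p} \<times> {..<Suc r})"
      by (simp add: graph_join_def complete_graph_def copies_def Plus_def)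
    have "bij_betw F S (Inl ` {..<k})"
    proof -
      have "bij_betw (Inl \<circ> l) S (Inl ` {..<k} :: (nat + nat \<times> nat) set)"
        using l by (rule bij_betw_trans) (auto simp: bij_betw_def)
      then show ?thesis by (rule bij_betw_cong[THEN iffD1, rotated]) (simp add: F_def)
    qed
    moreover have "bij_betw F (verts G - S) (Inr ` ({..<p} \<times> {..<Suc r}))"
    proof -
      have "bij_betw (Inr \<circ> q) (verts G - S) (Inr ` ({..<p} \<times> {..<Suc r}) :: (nat + nat \<times> nat) set)"
        using q by (rule bij_betw_trans) (auto simp: bij_betw_def)
      then show ?thesis by (rule bij_betw_cong[THEN iffD1, rotated]) (simp add: F_def)
    qed
    ultimately have "bij_betw F (S \<union> (verts G - S)) (verts ?J)"
      unfolding VJ by (rule bij_betw_combine) auto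
    then show "bij_betw F (verts G) (verts ?J)" using S by (simp add: Un_absorb1)
    fix u v assume uv: "u \<in> verts G" "v \<in> verts G"
    have lS: "l x < k" if "x \<in> S" for x using l that by (metis bij_betwE lessThan_iff)
    have l_eq: "l x = l y \<longleftrightarrow> x = y" if "x \<in> S" "y \<in> S" for x y
      using l that by (meson bij_betw_def inj_on_eq_iff)
    have qO: "q x \<in> {..<p} \<times> {..<Suc r}" if "x \<in> verts G - S" for x
      using q that by (metis bij_betwE)
    have mixed: "{x, y} \<in> edges G \<and> {F x, F y} \<in> edges ?J" if "x \<in> S" "y \<in> verts G - S" for x y
    proof -
      have "{x, y} \<in> edges G" using S_edge that by blast
      moreover have "{F x, F y} \<in> edges ?J"
        using that lS qO[OF that(2)] unfolding F_def
        by (simp add: edge_join_Inl_Inr complete_graph_def copies_def)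
      ultimately show ?thesis ..
    qed
    consider "u \<in> S" "v \<in> S" | "u \<in> S" "v \<notin> S" | "u \<notin> S" "v \<in> S" | "u \<notin> S" "v \<notin> S" by blast
    then show "{u, v} \<in> edges G \<longleftrightarrow> {F u, F v} \<in> edges ?J"
    proof cases
      case 1
      then have "{u, v} \<in> edges G \<longleftrightarrow> u \<noteq> v" using S_edge uv edgeD[OF simple] by metis
      then show ?thesis using 1 lS l_eq by (simp add: F_def edge_join_Inl_Inl edge_complete_graph_iff)
    next
      case 2
      then show ?thesis using mixed[of u v] uv by simp
    next
      case 3
      then show ?thesis using mixed[of v u] uv by (simp add: insert_commute)
    next
      case 4
      then have O: "u \<in> verts G - S" "v \<in> verts G - S" using uv by auto
      have "{F u, F v} \<in> edges ?J \<longleftrightarrow> g (cell u) = g (cell v) \<and> q u \<noteq> q v"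
        using 4 qO[OF O(1)] qO[OF O(2)]
        by (auto simp: F_def edge_join_Inr_Inr q_def edge_copies_iff edge_complete_graph_iff)
      also have "q u \<noteq> q v \<longleftrightarrow> u \<noteq> v" using q O by (meson bij_betw_def inj_on_eq_iff)
      also have "g (cell u) = g (cell v) \<longleftrightarrow> cell u = cell v"
        using g O by (intro inj_on_eq_iff[of g \<Q>]) (auto simp: bij_betw_def \<Q>_def)
      also have "cell u = cell v \<and> u \<noteq> v \<longleftrightarrow> v \<in> H u"
        using cell_eq_iff[OF O] not_mem_H_self by auto
      also have "\<dots> \<longleftrightarrow> {u, v} \<in> edges G"
        using mem_nbrs[OF simple] 4 by (simp add: H_def insert_commute)
      finally show ?thesis by simp
    qed
  qed
  then show ?thesis using card by blast
qed

end

text \<open>The preimage of the clique on \<open>k\<close> vertices serves as \<open>S\<close>;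
  outside it the neighbours of a vertex are the other \<open>r\<close> vertices of its copy.\<close>

lemma extremal_graph_structure:
  assumes G: "simple_graph G"
    and iso: "iso_graph G (graph_join (complete_graph k) (copies p (complete_graph (Suc r))))"
  obtains S where "S \<subseteq> verts G" "card S = k" "\<And>v. v \<in> S \<Longrightarrow> nbrs G v = verts G - {v}"
    "\<And>v. v \<in> verts G - S \<Longrightarrow> card (nbrs G v - S) = r"
proof -
  let ?J = "graph_join (complete_graph k) (copies p (complete_graph (Suc r)))"
  obtain f where f: "bij_betw f (verts G) (verts ?J)"
    and adj: "\<And>u v. u \<in> verts G \<Longrightarrow> v \<in> verts G \<Longrightarrow> {u, v} \<in> edges G \<longleftrightarrow> {f u, f v} \<in> edges ?J"
    using iso_graphD[OF G iso] by blast
  have VJ: "verts ?J = Inl ` {..<k} \<union> Inr ` ({..<p} \<times> {..<Suc r})"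
    by (simp add: graph_join_def complete_graph_def copies_def Plus_def)
  have inj: "inj_on f (verts G)" and img: "f ` verts G = verts ?J" using f by (auto simp: bij_betw_def)
  define S where "S = {v \<in> verts G. f v \<in> Inl ` {..<k}}"
  have SV: "S \<subseteq> verts G" by (auto simp: S_def)
  have nb: "u \<in> nbrs G v \<longleftrightarrow> u \<in> verts G \<and> {f u, f v} \<in> edges ?J" if "v \<in> verts G" for u v
    using adj that by (auto simp: nbrs_def)
  have "f ` S = Inl ` {..<k}"
  proof (intro equalityI subsetI)
    fix x :: "nat + nat \<times> nat" assume x: "x \<in> Inl ` {..<k}"
    then have "x \<in> f ` verts G" unfolding img VJ by blast
    then show "x \<in> f ` S" using x by (auto simp: S_def)
  qed (auto simp: S_def)
  moreover have "inj_on f S" using inj SV by (rule inj_on_subset)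
  ultimately have "card S = card (Inl ` {..<k} :: (nat + nat \<times> nat) set)" by (metis card_image)
  then have cS: "card S = k" by (simp add: card_image)
  have outside: "\<exists>a i. f v = Inr (a, i) \<and> a < p \<and> i < Suc r" if "v \<in> verts G - S" for v
  proof -
    have "f v \<in> verts ?J" "f v \<notin> Inl ` {..<k}" using that img by (auto simp: S_def)
    then show ?thesis unfolding VJ by auto
  qed
  have dom: "nbrs G v = verts G - {v}" if v: "v \<in> S" for v
  proof -
    have vV: "v \<in> verts G" using v SV by blast
    obtain i where i: "f v = Inl i" "i < k" using v by (auto simp: S_def)
    have "{f u, f v} \<in> edges ?J" if u: "u \<in> verts G" "u \<noteq> v" for u
    proof (cases "u \<in> S")
      case True
      then obtain j where j: "f u = Inl j" "j < k" by (auto simp: S_def)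
      moreover have "f u \<noteq> f v" using inj u vV by (meson inj_on_eq_iff)
      ultimately show ?thesis using i by (simp add: edge_join_Inl_Inl edge_complete_graph_iff)
    next
      case False
      then obtain a j where "f u = Inr (a, j)" "a < p" "j < Suc r" using outside u by blast
      then have "{f v, f u} \<in> edges ?J"
        using i by (simp add: edge_join_Inl_Inr complete_graph_def copies_def)
      then show ?thesis by (simp add: insert_commute)
    qed
    then show ?thesis using nb[OF vV] not_mem_nbrs_self[OF G] by blast
  qed
  have "card (nbrs G v - S) = r" if v: "v \<in> verts G - S" for v
  proof -
    obtain a i where ai: "f v = Inr (a, i)" "a < p" "i < Suc r" using outside v by blast
    have "f ` (nbrs G v - S) = Inr ` Pair a ` ({..<Suc r} - {i})"
    proof (intro equalityI subsetI)
      fix x assume "x \<in> f ` (nbrs G v - S)"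
      then obtain u where u: "u \<in> nbrs G v" "u \<notin> S" "x = f u" by blast
      then have uO: "u \<in> verts G - S" and e: "{f u, f v} \<in> edges ?J" using nb v by auto
      obtain b j where "f u = Inr (b, j)" using outside[OF uO] by blast
      then show "x \<in> Inr ` Pair a ` ({..<Suc r} - {i})"
        using e u(3) ai by (auto simp: edge_join_Inr_Inr edge_copies_iff edge_complete_graph_iff)
    next
      fix x :: "nat + nat \<times> nat" assume "x \<in> Inr ` Pair a ` ({..<Suc r} - {i})"
      then obtain j where j: "x = Inr (a, j)" "j < Suc r" "j \<noteq> i" by blast
      then have "x \<in> f ` verts G" using ai unfolding img VJ by auto
      then obtain u where u: "u \<in> verts G" "x = f u" by blast
      then have "{f u, f v} \<in> edges ?J" using j ai
        by (simp add: edge_join_Inr_Inr edge_copies_iff edge_complete_graph_iff flip: u(2))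
      moreover have "u \<notin> S" using u j by (auto simp: S_def)
      ultimately show "x \<in> f ` (nbrs G v - S)" using u v nb by blast
    qed
    moreover have "inj_on f (nbrs G v - S)" using inj by (rule inj_on_subset) (use nbrs_subset_verts[of G v] in auto)
    ultimately have "card (nbrs G v - S) = card ((Inr ` Pair a ` ({..<Suc r} - {i})) :: (nat + nat \<times> nat) set)"
      by (metis card_image)
    also have "\<dots> = card ({..<Suc r} - {i})"
      by (simp add: card_image inj_on_def)
    finally show ?thesis using ai by simp
  qed
  then show ?thesis using that SV cS dom by blast
qed

section \<open>From minor-freeness to the extremal graph\<close>

lemma bipartite_free_graph_of_minor_free:
  assumes G: "simple_graph G" and "minor_free (complete_bipartite s t) G" and "s > 0"
  shows "bipartite_free_graph G s t"
proof
  fix X assume X: "X \<subseteq> verts G" "card X = s"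
  show "card {v \<in> verts G. X \<subseteq> nbrs G v} < t"
  proof (rule ccontr)
    assume "\<not> ?thesis"
    then have "t \<le> card {v \<in> verts G. X \<subseteq> nbrs G v}" by simp
    then obtain Y where Y: "Y \<subseteq> {v \<in> verts G. X \<subseteq> nbrs G v}" "card Y = t"
      by (rule obtain_subset_with_card_n)
    have "has_minor G (complete_bipartite s t)"
    proof (rule has_minor_complete_bipartite_subgraph[OF G X(1) _ _ X(2) Y(2)])
      show "Y \<subseteq> verts G" using Y by auto
      show "X \<inter> Y = {}" using Y not_mem_nbrs_self[OF G] by blast
      show "{x, y} \<in> edges G" if "x \<in> X" "y \<in> Y" for x y
        using that Y mem_nbrs[OF G, of x y] by auto
    qed
    then show False using assms by simp
  qed
qed (use assms in auto)

text \<open>Absolute values turn the eigenvalue equation into an inequality by the triangle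
  inequality; dividing by the largest one gives an entry 1.\<close>

lemma sub_eigenvector_of_eigenvector:
  assumes free: "bipartite_free_graph G s t" and \<alpha>: "0 < \<alpha>" "\<alpha> < 1"
    and eig: "eigenvalue (A_alpha \<alpha> G) lam" and lam: "\<alpha> * (real (card (verts G)) - 1) \<le> lam"
  obtains x u where "sub_eigenvector G s t \<alpha> lam x" "u \<in> verts G" "x u = 1"
proof -
  interpret bipartite_free_graph G s t by fact
  obtain z where z: "\<exists>u\<in>verts G. z u \<noteq> 0"
    and zeq: "\<And>u. u \<in> verts G \<Longrightarrow> \<alpha> * real (deg u) * z u + (1 - \<alpha>) * (\<Sum>v\<in>nbrs G u. z v) = lam * z u"
    using eig unfolding eigenvalue_A_alpha_iff[OF simple] vdegree_nbrs by blast
  define m where "m = Max ((\<lambda>u. \<bar>z u\<bar>) ` verts G)"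
  have fin: "finite ((\<lambda>u. \<bar>z u\<bar>) ` verts G)" using finV by simp
  have le: "\<bar>z u\<bar> \<le> m" if "u \<in> verts G" for u unfolding m_def using fin that by simp
  have "m > 0"
  proof -
    obtain u where "u \<in> verts G" "z u \<noteq> 0" using z by blast
    then show ?thesis using le[of u] by simp
  qed
  have "m \<in> (\<lambda>u. \<bar>z u\<bar>) ` verts G" unfolding m_def using fin z by (intro Max_in) auto
  then obtain u where u: "u \<in> verts G" "\<bar>z u\<bar> = m" by blast
  define x where "x v = \<bar>z v\<bar> / m" for v
  have "sub_eigenvector G s t \<alpha> lam x"
  proof unfold_locales
    fix v assume v: "v \<in> verts G"
    show "0 \<le> x v" "x v \<le> 1" using \<open>m > 0\<close> le[OF v] by (auto simp: x_def)
    \<comment> \<open>Valid for either sign of the coefficient.\<close>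
    have "(lam - \<alpha> * real (deg v)) * \<bar>z v\<bar> \<le> \<bar>(lam - \<alpha> * real (deg v)) * z v\<bar>"
      by (simp add: abs_mult mult_right_mono)
    also have "(lam - \<alpha> * real (deg v)) * z v = (1 - \<alpha>) * (\<Sum>w\<in>nbrs G v. z w)"
      using zeq[OF v] by (simp add: algebra_simps)
    also have "\<bar>(1 - \<alpha>) * (\<Sum>w\<in>nbrs G v. z w)\<bar> = (1 - \<alpha>) * \<bar>\<Sum>w\<in>nbrs G v. z w\<bar>"
      using \<alpha> by (simp add: abs_mult)
    also have "\<dots> \<le> (1 - \<alpha>) * (\<Sum>w\<in>nbrs G v. \<bar>z w\<bar>)"
      using \<alpha> by (intro mult_left_mono sum_abs) auto
    finally have "(lam - \<alpha> * real (deg v)) * \<bar>z v\<bar> / m \<le> (1 - \<alpha>) * (\<Sum>w\<in>nbrs G v. \<bar>z w\<bar>) / m"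
      using \<open>m > 0\<close> by (intro divide_right_mono) auto
    then show "(lam - \<alpha> * real (deg v)) * x v \<le> (1 - \<alpha>) * (\<Sum>w\<in>nbrs G v. x w)"
      by (simp add: x_def flip: sum_divide_distrib)
  qed (use \<alpha> lam in auto)
  moreover have "x u = 1" using u \<open>m > 0\<close> by (simp add: x_def)
  ultimately show ?thesis using that u(1) by blast
qed

lemma (in dominated_graph) largest_root_is_eigenvalue:
  assumes "\<And>v. v \<in> verts G - S \<Longrightarrow> card (nbrs G v - S) = r"
  shows "eigenvalue (A_alpha \<alpha> G) \<rho>"
  unfolding eigenvalue_A_alpha_iff[OF simple] vdegree_nbrs
proof (intro exI[of _ y] conjI ballI)
  obtain u where "u \<in> S" using S by (metis card.empty equals0I less_irrefl)
  then show "\<exists>u\<in>verts G. y u \<noteq> 0" using S(1) y_pos[of u] by (metis less_irrefl subsetD)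
  show "\<alpha> * real (card (nbrs G u)) * y u + (1 - \<alpha>) * (\<Sum>v\<in>nbrs G u. y v) = \<rho> * y u"
    if "u \<in> verts G" for u
    using eigenvector_of_regular[OF assms that] by (simp add: Ay_def)
qed

lemma dominated_graph_largest_root:
  fixes G :: "'a ugraph" and \<alpha> :: real and k r :: nat
  defines "\<rho> \<equiv> largest_root (f_alpha (Suc k) (Suc r) (card (verts G)) \<alpha>)"
  assumes "simple_graph G" "S \<subseteq> verts G" "card S = k" "k > 0"
    and "\<And>v. v \<in> S \<Longrightarrow> nbrs G v = verts G - {v}"
    and "\<And>v. v \<in> verts G - S \<Longrightarrow> card (nbrs G v - S) \<le> r"
    and "0 < \<alpha>" "\<alpha> < 1" "\<alpha> * real k + real r < \<rho>" "Suc k \<le> card (verts G)"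
  shows "dominated_graph G S k r \<alpha> \<rho> ((\<rho> - (\<alpha> * real k + real r)) / ((1 - \<alpha>) * real k))"
proof
  show "(\<rho> - (\<alpha> * (real (card (verts G)) - real k) + real k - 1)) * (\<rho> - (\<alpha> * real k + real r))
      = (1 - \<alpha>)\<^sup>2 * real k * (real (card (verts G)) - real k)"
    using largest_root_eq[of "Suc k" "card (verts G)" "Suc r" \<alpha>] assms(11)
    unfolding \<rho>_def by (simp add: algebra_simps)
qed (use assms in auto)

text \<open>The bound and the equality case are obtained at once: an index of at least the root is
  shown to equal it and to force the extremal graph.\<close>

lemma eventually_extremal:
  fixes k r :: nat and \<alpha> :: real
  assumes k: "k > 0" "k \<le> r" and \<alpha>: "0 < \<alpha>" "\<alpha> < 1"
  shows "\<forall>\<^sub>F n in sequentially. \<forall>G :: 'a ugraph.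
    simple_graph G \<longrightarrow> card (verts G) = n \<longrightarrow> minor_free (complete_bipartite (Suc k) (Suc r)) G \<longrightarrow>
    largest_root (f_alpha (Suc k) (Suc r) n \<alpha>) \<le> alpha_index \<alpha> G \<longrightarrow>
    alpha_index \<alpha> G = largest_root (f_alpha (Suc k) (Suc r) n \<alpha>) \<and>
    (\<exists>p. n = k + p * Suc r \<and> iso_graph G (graph_join (complete_graph k) (copies p (complete_graph (Suc r)))))"
proof -
  define Q where "Q = (1 - \<alpha>) * (real k / \<alpha> - 1)"
  define \<eta> where "\<eta> = \<alpha> * (1 - \<alpha>) / (4 * (2 + Q))"
  have "real k / \<alpha> > 1" using k \<alpha> by (simp add: field_simps)
  then have "Q > 0" using \<alpha> by (simp add: Q_def)
  then have "\<eta> > 0" unfolding \<eta>_def using \<alpha> by (intro divide_pos_pos mult_pos_pos) auto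
  note eventually_dominating_set[OF \<alpha> k(1) Q_def \<eta>_def, of "Suc r", where 'a = 'a]
  moreover have "\<forall>\<^sub>F n in sequentially. \<alpha> * (real n - 1) + Q - \<eta> \<le> largest_root (f_alpha (Suc k) (Suc r) n \<alpha>)"
    unfolding Q_def using \<alpha> \<open>\<eta> > 0\<close> by (rule eventually_largest_root_ge)
  \<comment> \<open>Taking \<open>Q\<close> itself as the error leaves
    \<open>\<alpha> * (n - 1)\<close>, the lower bound on \<open>lam\<close> required by
    \<open>sub_eigenvector\<close>.\<close>
  moreover have "\<forall>\<^sub>F n in sequentially. \<alpha> * (real n - 1) + Q - Q \<le> largest_root (f_alpha (Suc k) (Suc r) n \<alpha>)"
    using eventually_largest_root_ge[OF \<alpha> \<open>Q > 0\<close>, of k "Suc r"] unfolding Q_def[symmetric] .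
  moreover have "\<forall>\<^sub>F n in sequentially. \<alpha> * real k + real r < largest_root (f_alpha (Suc k) (Suc r) n \<alpha>)"
    using \<alpha> by (rule eventually_largest_root_gt_const)
  moreover have "\<forall>\<^sub>F n in sequentially. Suc k \<le> n" by (rule eventually_ge_at_top)
  ultimately show ?thesis
  proof eventually_elim
    case (elim n)
    define \<rho> where "\<rho> = largest_root (f_alpha (Suc k) (Suc r) n \<alpha>)"
    show ?case unfolding \<rho>_def[symmetric]
    proof (intro allI impI)
      fix G :: "'a ugraph"
      assume G: "simple_graph G" and n: "card (verts G) = n"
        and mf: "minor_free (complete_bipartite (Suc k) (Suc r)) G" and ge: "\<rho> \<le> alpha_index \<alpha> G"
      define lam where "lam = alpha_index \<alpha> G"
      have free: "bipartite_free_graph G (Suc k) (Suc r)"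
        using G mf by (intro bipartite_free_graph_of_minor_free) auto
      have "\<alpha> * (real n - 1) \<le> lam" using elim(3) ge unfolding \<rho>_def lam_def by linarith
      moreover have "eigenvalue (A_alpha \<alpha> G) lam"
        unfolding lam_def using elim(5) n by (intro alpha_index_eigenvalue) (simp add: graph_order_def)
      ultimately obtain x u where x: "sub_eigenvector G (Suc k) (Suc r) \<alpha> lam x" "u \<in> verts G" "x u = 1"
        using sub_eigenvector_of_eigenvector[OF free \<alpha>] n by metis
      interpret x: sub_eigenvector G "Suc k" "Suc r" \<alpha> lam x by (fact x(1))
      have "\<alpha> * (real n - 1) + Q - \<eta> \<le> lam" using elim(2) ge unfolding \<rho>_def lam_def by linarith
      then obtain S where dS: "S \<subseteq> verts G" "card S = k" "u \<in> S" and
        deg: "\<And>v. v \<in> S \<Longrightarrow> card (nbrs G v) = n - 1"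
        using elim(1)[rule_format, OF x(1) n _ x(2,3)] by metis
      have finS: "finite S" using dS(1) x.finV finite_subset by blast
      have dom: "nbrs G v = verts G - {v}" if v: "v \<in> S" for v
      proof (rule card_subset_eq)
        show "nbrs G v \<subseteq> verts G - {v}" using nbrs_subset_verts[of G v] not_mem_nbrs_self[OF G] by blast
        show "card (nbrs G v) = card (verts G - {v})" using deg[OF v] v dS(1) n x.finV by (simp add: subsetD)
      qed (use x.finV in auto)
      \<comment> \<open>The \<open>Suc k\<close> vertices of \<open>insert v S\<close> have all of
        \<open>nbrs G v - S\<close> as common neighbours.\<close>
      have le: "card (nbrs G v - S) \<le> r" if v: "v \<in> verts G - S" for v
      proof -
        have "card {w \<in> verts G. insert v S \<subseteq> nbrs G w} < Suc r"
          using v dS finS by (intro x.bipartite_free) auto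
        moreover have "nbrs G v - S \<subseteq> {w \<in> verts G. insert v S \<subseteq> nbrs G w}"
          using dS(1) dom nbrs_sym[OF G] nbrs_subset_verts[of G v] by auto
        then have "card (nbrs G v - S) \<le> card {w \<in> verts G. insert v S \<subseteq> nbrs G w}"
          using x.finV by (intro card_mono) auto
        ultimately show ?thesis by simp
      qed
      have "dominated_graph G S k r \<alpha> \<rho> ((\<rho> - (\<alpha> * real k + real r)) / ((1 - \<alpha>) * real k))"
        using dominated_graph_largest_root[OF G dS(1,2) k(1) dom le \<alpha>] elim(4,5)
        unfolding n \<rho>_def by blast
      then interpret dominated_graph G S k r \<alpha> \<rho> "(\<rho> - (\<alpha> * real k + real r)) / ((1 - \<alpha>) * real k)" .
      have sub: "lam * x v \<le> \<alpha> * real (card (nbrs G v)) * x v + (1 - \<alpha>) * (\<Sum>w\<in>nbrs G v. x w)"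
        if "v \<in> verts G" for v
        using x.sub[OF that] by (simp add: algebra_simps)
      have xu: "x u > 0" using x(3) by simp
      have "lam \<le> \<rho>" using sub_eigenvalue_le[OF x.x_nonneg x(2) xu sub] .
      then have lam: "lam = \<rho>" using ge by (simp add: lam_def)
      have reg: "card (nbrs G v - S) = r" if "v \<in> verts G - S" for v
        using regular_of_sub_eigenvalue_eq[OF x.x_nonneg x(2) xu sub lam dS(3) that] .
      interpret R: regular_remainder G S k r
        using G dS(1,2) k dom reg mf by unfold_locales auto
      show "alpha_index \<alpha> G = \<rho> \<and>
        (\<exists>p. n = k + p * Suc r \<and> iso_graph G (graph_join (complete_graph k) (copies p (complete_graph (Suc r)))))"
        using R.iso_join_cliques lam n by (simp add: lam_def)
    qed
  qed
qed

theorem theorem1p2: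
  fixes s t :: nat and \<alpha> :: real
  assumes "t \<ge> s" and "s \<ge> 2" and "0 < \<alpha>" and "\<alpha> < 1"
  shows "\<forall>\<^sub>F n in sequentially. \<forall>G :: 'a ugraph.
           simple_graph G \<and> graph_order G = n \<and> minor_free (complete_bipartite s t) G \<longrightarrow>
             alpha_index \<alpha> G \<le> largest_root (f_alpha s t n \<alpha>) \<and>
             (alpha_index \<alpha> G = largest_root (f_alpha s t n \<alpha>) \<longleftrightarrow>
               (\<exists>p :: nat. int n - int s + 1 = int p * int t \<and>
                  iso_graph G (graph_join (complete_graph (s - 1)) (copies p (complete_graph t)))))"
proof -
  define k r where "k = s - 1" and "r = t - 1"
  have st: "s = Suc k" "t = Suc r" and k: "k > 0" "k \<le> r" using assms by (auto simp: k_def r_def)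
  have "\<forall>\<^sub>F n in sequentially. \<alpha> * real k + real r < largest_root (f_alpha (Suc k) (Suc r) n \<alpha>)"
    using assms(3,4) by (rule eventually_largest_root_gt_const)
  moreover have "\<forall>\<^sub>F n in sequentially. Suc k \<le> n" by (rule eventually_ge_at_top)
  moreover note eventually_extremal[OF k assms(3,4), where 'a = 'a]
  ultimately show ?thesis unfolding st
  proof eventually_elim
    case (elim n)
    define \<rho> where "\<rho> = largest_root (f_alpha (Suc k) (Suc r) n \<alpha>)"
    show ?case unfolding \<rho>_def[symmetric]
    proof (intro allI impI)
      fix G :: "'a ugraph"
      assume "simple_graph G \<and> graph_order G = n \<and> minor_free (complete_bipartite (Suc k) (Suc r)) G"
      then have G: "simple_graph G" and n: "card (verts G) = n"
        and mf: "minor_free (complete_bipartite (Suc k) (Suc r)) G" by (auto simp: graph_order_def)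
      have ext: "alpha_index \<alpha> G = \<rho> \<and> (\<exists>p. n = k + p * Suc r
          \<and> iso_graph G (graph_join (complete_graph k) (copies p (complete_graph (Suc r)))))"
        if "\<rho> \<le> alpha_index \<alpha> G"
        using elim(3) G n mf that unfolding \<rho>_def by blast
      \<comment> \<open>An index above \<rho> would equal \<rho> by \<open>ext\<close>.\<close>
      then have le: "alpha_index \<alpha> G \<le> \<rho>" by linarith
      have eqI: "alpha_index \<alpha> G = \<rho>" if iso: "iso_graph G (graph_join (complete_graph k) (copies p (complete_graph (Suc r))))" for p
      proof -
        obtain S where S: "S \<subseteq> verts G" "card S = k" "\<And>v. v \<in> S \<Longrightarrow> nbrs G v = verts G - {v}"
          and reg: "\<And>v. v \<in> verts G - S \<Longrightarrow> card (nbrs G v - S) = r"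
          using extremal_graph_structure[OF G iso] by metis
        have "dominated_graph G S k r \<alpha> \<rho> ((\<rho> - (\<alpha> * real k + real r)) / ((1 - \<alpha>) * real k))"
          using dominated_graph_largest_root[OF G S(1,2) k(1) S(3) _ assms(3,4), of r] reg elim(1,2)
          unfolding n \<rho>_def by simp
        \<comment> \<open>Regularity makes the comparison vector an eigenvector, so the index is at
          least \<rho>.\<close>
        then have "eigenvalue (A_alpha \<alpha> G) \<rho>"
          using reg by (rule dominated_graph.largest_root_is_eigenvalue)
        then show ?thesis using le eigenvalue_le_alpha_index by (metis antisym)
      qed
      show "alpha_index \<alpha> G \<le> \<rho> \<and> (alpha_index \<alpha> G = \<rho> \<longleftrightarrow>
          (\<exists>p. int n - int (Suc k) + 1 = int p * int (Suc r) \<and>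
            iso_graph G (graph_join (complete_graph (Suc k - 1)) (copies p (complete_graph (Suc r))))))"
      proof (intro conjI iffI)
        assume "alpha_index \<alpha> G = \<rho>"
        then obtain p where p: "n = k + p * Suc r"
          "iso_graph G (graph_join (complete_graph k) (copies p (complete_graph (Suc r))))"
          using ext by auto
        have "int n - int (Suc k) + 1 = int p * int (Suc r)" using p(1) by (simp add: algebra_simps)
        then show "\<exists>p. int n - int (Suc k) + 1 = int p * int (Suc r) \<and>
            iso_graph G (graph_join (complete_graph (Suc k - 1)) (copies p (complete_graph (Suc r))))"
          using p(2) by (intro exI[of _ p]) simp
      next
        assume "\<exists>p. int n - int (Suc k) + 1 = int p * int (Suc r) \<and>
            iso_graph G (graph_join (complete_graph (Suc k - 1)) (copies p (complete_graph (Suc r))))"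
        then show "alpha_index \<alpha> G = \<rho>" using eqI by auto
      qed (rule le)
    qed
  qed
qed

end
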